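(* Let $C$ be a real plane cubic curve with defining polynomial $f_C\in\mathbb{R}[x,y]$ of degree $3$ whose partial derivatives $\frac{\partial f_C}{\partial x},\frac{\partial f_C}{\partial y}$ are linearly independent over $\mathbb{R}$, and let $(f_C)_3$ be the cubic homogeneous component of $f_C$. Then $C$ falls into exactly one of the four Newton canonical forms (N1) $xy^2+ey=ax^3+bx^2+cx+d$, (N2) $xy=ax^3+bx^2+cx+d$, (N3) $y^2=ax^3+bx^2+cx+d$, (N4) $y=ax^3+bx^2+cx+d$, and moreover: (1) $C$ is of form (N4) if and only if $Z(f_C)=Z((f_C)_3)\cong T$. (2) $C$ is of form (N3) if and only if $\mathbb{R}^2\cong Z(f_C)\subset Z((f_C)_3)\cong T$. (3) $C$ is of form (N2) if and only if $\mathbb{R}[\epsilon]/\langle\epsilon^2\rangle\cong Z(f_C)\subset Z((f_C)_3)\cong T$. (4) $C$ is of form (N1) if and only if $\dim_{\mathbb{R}} Z((f_C)_3)=2$.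
   Context: For a polynomial $f\in\mathbb{R}[x,y]$ with Hessian matrix $H_f$ (the matrix of second partial derivatives), the center of $f$ is $Z(f)=\{X\in\mathbb{R}^{2\times2}\mid(H_fX)^T=H_fX\}$ (equality of matrices with polynomial entries). Two polynomials $f,g\in\mathbb{R}[x,y]$ are equivalent, written $f\sim g$, if there exist $P\in\operatorname{GL}(2,\mathbb{R})$, $v\in\mathbb{R}^2$ and $\lambda\in\mathbb{R}\setminus\{0\}$ such that $g(u)=\lambda f(Pu+v)$, where $u=(x,y)^T$. A cubic curve is identified with its defining polynomial. The curve $C$ "is of Newton's canonical form (N$i$)" means that, for some real $a,b,c,d$ (and $e$ for (N1)), $f_C$ is equivalent to the polynomial obtained as the difference of the two sides of equation (N$i$). (Since $f_C$ has degree $3$, $a\neq0$ automatically in (N2)–(N4).) $T=\left\{\begin{pmatrix} s & 0 \\ r & t \end{pmatrix}\;\middle|\;r,s,t\in\mathbb{R}\right\}$ is the algebra of $2\times2$ real lower-triangular matrices. The symbol $\cong$ denotes isomorphism of $\mathbb{R}$-algebras, centers being equipped with matrix multiplication (under which they are closed in each case listed). *)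

theory Defs
  imports
    "HOL-Algebra.QuotRing"
    "HOL-Algebra.Module"
    "HOL-Analysis.Analysis"
    "HOL-Computational_Algebra.Polynomial"
begin

unbundle no fps_syntax

subsection \<open>Bivariate real polynomials\<close>

text \<open>
  The ring of real polynomials in \<open>x\<close> and \<open>y\<close> is taken as the ring of polynomials in \<open>y\<close> over the
  polynomials in \<open>x\<close>: the coefficient of \<open>x\<^sup>i y\<^sup>j\<close> in \<open>f\<close> is \<open>coeff (coeff f j) i\<close>.
\<close>

type_synonym bipoly = "real poly poly"

definition const_bp :: "real \<Rightarrow> bipoly" where
  "const_bp a = [:[:a:]:]"

definition x_bp :: bipoly where
  "x_bp = [:[:0, 1:]:]"

definition y_bp :: bipoly where
  "y_bp = [:0, 1:]"

definition bcoeff :: "bipoly \<Rightarrow> nat \<Rightarrow> nat \<Rightarrow> real" where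
  "bcoeff f i j = coeff (coeff f j) i"

definition total_degree :: "bipoly \<Rightarrow> nat" where
  "total_degree f = (if f = 0 then 0 else Max {i + j |i j. bcoeff f i j \<noteq> 0})"

definition homogeneous_component :: "nat \<Rightarrow> bipoly \<Rightarrow> bipoly" where
  "homogeneous_component n f =
     (\<Sum>i\<le>n. const_bp (bcoeff f i (n - i)) * x_bp ^ i * y_bp ^ (n - i))"

definition dx :: "bipoly \<Rightarrow> bipoly" where
  "dx f = map_poly pderiv f"

definition dy :: "bipoly \<Rightarrow> bipoly" where
  "dy f = pderiv f"

definition partials_lin_indep :: "bipoly \<Rightarrow> bool" where
  "partials_lin_indep f \<longleftrightarrow>
     (\<forall>a b. const_bp a * dx f + const_bp b * dy f = 0 \<longrightarrow> a = 0 \<and> b = 0)"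

definition subst_bp :: "bipoly \<Rightarrow> bipoly \<Rightarrow> bipoly \<Rightarrow> bipoly" where \<comment> \<open>\<open>f(p, q)\<close>\<close>
  "subst_bp f p q = poly (map_poly (\<lambda>c. poly (map_poly const_bp c) p) f) q"

definition equivalent_bp :: "bipoly \<Rightarrow> bipoly \<Rightarrow> bool" (infix \<open>\<sim>\<^sub>b\<close> 50) where
  "f \<sim>\<^sub>b g \<longleftrightarrow>
     (\<exists>(P :: real^2^2) (v :: real^2) (l :: real). invertible P \<and> l \<noteq> 0 \<and>
        g = const_bp l * subst_bp f
              (const_bp (P$1$1) * x_bp + const_bp (P$1$2) * y_bp + const_bp (v$1))
              (const_bp (P$2$1) * x_bp + const_bp (P$2$2) * y_bp + const_bp (v$2)))"


subsection \<open>Hessian matrix and center\<close>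

definition hessian :: "bipoly \<Rightarrow> bipoly^2^2" where
  "hessian f = vector [vector [dx (dx f), dy (dx f)], vector [dx (dy f), dy (dy f)]]"

definition const_matrix :: "real^2^2 \<Rightarrow> bipoly^2^2" where
  "const_matrix X = (\<chi> i j. const_bp (X$i$j))"

definition center :: "bipoly \<Rightarrow> (real^2^2) set" where
  "center f = {X. transpose (hessian f ** const_matrix X) = hessian f ** const_matrix X}"


subsection \<open>Newton's canonical forms\<close>

datatype newton_form = N1 | N2 | N3 | N4

fun of_newton_form :: "newton_form \<Rightarrow> bipoly \<Rightarrow> bool" where
  "of_newton_form N1 f \<longleftrightarrow> (\<exists>a b c d e.
     f \<sim>\<^sub>b x_bp * y_bp^2 + const_bp e * y_bp -
         (const_bp a * x_bp^3 + const_bp b * x_bp^2 + const_bp c * x_bp + const_bp d))"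
| "of_newton_form N2 f \<longleftrightarrow> (\<exists>a b c d.
     f \<sim>\<^sub>b x_bp * y_bp -
         (const_bp a * x_bp^3 + const_bp b * x_bp^2 + const_bp c * x_bp + const_bp d))"
| "of_newton_form N3 f \<longleftrightarrow> (\<exists>a b c d.
     f \<sim>\<^sub>b y_bp^2 -
         (const_bp a * x_bp^3 + const_bp b * x_bp^2 + const_bp c * x_bp + const_bp d))"
| "of_newton_form N4 f \<longleftrightarrow> (\<exists>a b c d.
     f \<sim>\<^sub>b y_bp -
         (const_bp a * x_bp^3 + const_bp b * x_bp^2 + const_bp c * x_bp + const_bp d))"


subsection \<open>Real algebras and their isomorphisms\<close>

text \<open>
  The locale \<open>algebra\<close> of HOL-Algebra covers only commutative algebras, so the following associative
  unital notion is built from \<^locale>\<open>ring\<close> and \<^locale>\<open>Module.module\<close>.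
\<close>

definition reals_ring :: "real ring" where
  "reals_ring = \<lparr>carrier = UNIV, monoid.mult = (*), one = 1, zero = 0, add = (+)\<rparr>"

definition real_assoc_algebra :: "(real, 'a) module \<Rightarrow> bool" where
  "real_assoc_algebra A \<longleftrightarrow>
     ring A \<and> Module.module reals_ring A \<and>
     (\<forall>r. \<forall>x \<in> carrier A. \<forall>y \<in> carrier A.
        (r \<odot>\<^bsub>A\<^esub> x) \<otimes>\<^bsub>A\<^esub> y = r \<odot>\<^bsub>A\<^esub> (x \<otimes>\<^bsub>A\<^esub> y) \<and>
        x \<otimes>\<^bsub>A\<^esub> (r \<odot>\<^bsub>A\<^esub> y) = r \<odot>\<^bsub>A\<^esub> (x \<otimes>\<^bsub>A\<^esub> y))"

text \<open>
  Both sides are required to be algebras; for a set of matrices this includes closure under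
  multiplication.
\<close>

definition alg_isomorphic :: "(real, 'a) module \<Rightarrow> (real, 'b) module \<Rightarrow> bool" (infix \<open>\<cong>\<^sub>A\<close> 50) where
  "A \<cong>\<^sub>A B \<longleftrightarrow> real_assoc_algebra A \<and> real_assoc_algebra B \<and>
     (\<exists>h \<in> ring_iso A B. \<forall>r. \<forall>x \<in> carrier A. h (r \<odot>\<^bsub>A\<^esub> x) = r \<odot>\<^bsub>B\<^esub> h x)"

text \<open>The class operation \<open>*\<close> on \<^typ>\<open>real^2^2\<close> is entrywise; the matrix product is \<open>**\<close>.\<close>

definition matrix_alg :: "(real^2^2) set \<Rightarrow> (real, real^2^2) module" where
  "matrix_alg S = \<lparr>carrier = S, monoid.mult = (**), one = mat 1, zero = 0, add = (+),
                   module.smult = scaleR\<rparr>"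

definition lower_triangular :: "(real^2^2) set" where
  "lower_triangular = {vector [vector [s, 0], vector [r, t]] |r s t. True}"

text \<open>Multiplication on \<^typ>\<open>real^2\<close> is componentwise.\<close>

definition R2_alg :: "(real, real^2) module" where
  "R2_alg = \<lparr>carrier = UNIV, monoid.mult = (*), one = 1, zero = 0, add = (+), module.smult = scaleR\<rparr>"

definition poly_alg :: "(real, real poly) module" where
  "poly_alg = \<lparr>carrier = UNIV, monoid.mult = (*), one = 1, zero = 0, add = (+),
               module.smult = Polynomial.smult\<rparr>"

text \<open>The scalar action on cosets follows the pattern of \<^const>\<open>rcoset_mult\<close>.\<close>

definition quotient_alg :: "(real, 'a) module \<Rightarrow> 'a set \<Rightarrow> (real, 'a set) module" where
  "quotient_alg A I =
     ring.extend (A Quot I) \<lparr>module.smult = (\<lambda>r C. \<Union>x\<in>C. I +>\<^bsub>A\<^esub> (r \<odot>\<^bsub>A\<^esub> x))\<rparr>"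

definition dual_numbers_alg :: "(real, real poly set) module" where
  "dual_numbers_alg = quotient_alg poly_alg (Idl\<^bsub>poly_alg\<^esub> {[:0, 1:]^2})"

end

theory Submission
  imports Defs
begin

text \<open>
  An affine change of coordinates with linear part \<open>P\<close> turns the Hessian \<open>H\<close> into a multiple of
  \<open>P\<^sup>T (H \<circ> P) P\<close>, so it conjugates the centers of \<open>f\<close> and of its cubic part by the same matrix \<open>P\<close>.
  The isomorphism types, inclusions and dimensions in question can therefore be read off from any
  normal form that \<open>f\<close> reaches, and they differ between the four forms: the center of the cubic part
  is lower triangular if the cubic part is the cube of a linear form, and is a commutative algebra of
  dimension 2 otherwise; in the former case a quadratic part containing \<open>y\<^sup>2\<close>, only \<open>x y\<close>, or neither
  leaves the diagonal matrices, the dual numbers, or everything.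

  A normal form is reached because a real binary cubic form has a real linear factor. If the cubic
  part becomes \<open>a x\<^sup>3\<close>, then completing the square (or shifting \<open>x\<close>) yields (N2), (N3) or (N4), and
  the linear independence of the partial derivatives rules out that \<open>y\<close> does not occur at all.
\<close>

section \<open>Evaluation and the equivalence relation\<close>

definition ev :: "bipoly \<Rightarrow> real \<Rightarrow> real \<Rightarrow> real" where
  "ev f x y = poly (poly f [:y:]) x"

lemma ev_simps [simp]:
  "ev (f + g) x y = ev f x y + ev g x y"
  "ev (f - g) x y = ev f x y - ev g x y"
  "ev (f * g) x y = ev f x y * ev g x y"
  "ev (f ^ n) x y = ev f x y ^ n"
  "ev (const_bp a) x y = a"
  "ev x_bp x y = x"
  "ev y_bp x y = y"
  by (simp_all add: ev_def const_bp_def x_bp_def y_bp_def)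

text \<open>For each fixed y the difference is a polynomial in x vanishing everywhere, hence zero.
  So the difference, viewed over the coefficient ring of polynomials in x, has the infinitely many
  roots \<open>[:y:]\<close> and must itself be zero.\<close>

lemma bipoly_eqI:
  assumes "\<And>x y. ev f x y = ev g x y"
  shows "f = g"
proof -
  have "poly (f - g) [:y:] = 0" for y
    using assms by (auto simp: ev_def intro!: poly_ext)
  then have "range (\<lambda>y. [:y:]) \<subseteq> {c. poly (f - g) c = 0}"
    by auto
  moreover have "infinite (range (\<lambda>y::real. [:y:]))"
    by (simp add: finite_image_iff inj_def infinite_UNIV_char_0)
  ultimately have "f - g = 0"
    using poly_roots_finite finite_subset by blast
  then show ?thesis
    by simp
qed

lemma ev_subst_bp: "ev (subst_bp f p q) x y = ev f (ev p x y) (ev q x y)"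
proof -
  have inner: "ev (poly (map_poly const_bp c) p) x y = poly c (ev p x y)" for c
  proof (induction c)
    case 0
    then show ?case by (simp add: ev_def)
  next
    case (pCons a c)
    have "const_bp 0 = 0" by (simp add: const_bp_def)
    with pCons show ?case by (simp add: map_poly_pCons)
  qed
  show ?thesis
  proof (induction f)
    case 0
    then show ?case by (simp add: ev_def subst_bp_def)
  next
    case (pCons c f)
    have "subst_bp (pCons c f) p q = poly (map_poly const_bp c) p + q * subst_bp f p q"
      by (simp add: subst_bp_def map_poly_pCons)
    with pCons inner show ?case by (simp add: ev_def)
  qed
qed

text \<open>By \<open>bipoly_eqI\<close> the defining equation may be tested pointwise. With the
  entries of \<open>P\<close> and \<open>v\<close> as plain real variables, invertibility becomes a
  nonzero determinant and later arguments become real arithmetic.\<close>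

lemma equivalent_bp_iff:
  "f \<sim>\<^sub>b g \<longleftrightarrow> (\<exists>p q r s m n l. p * s - q * r \<noteq> 0 \<and> l \<noteq> 0 \<and>
     (\<forall>x y. ev g x y = l * ev f (p * x + q * y + m) (r * x + s * y + n)))"
    (is "?L \<longleftrightarrow> ?R")
proof
  assume ?L
  then obtain P :: "real^2^2" and v :: "real^2" and l where
    "invertible P" "l \<noteq> 0" and g: "g = const_bp l * subst_bp f
              (const_bp (P$1$1) * x_bp + const_bp (P$1$2) * y_bp + const_bp (v$1))
              (const_bp (P$2$1) * x_bp + const_bp (P$2$2) * y_bp + const_bp (v$2))"
    unfolding equivalent_bp_def by blast
  have "P$1$1 * P$2$2 - P$1$2 * P$2$1 \<noteq> 0"
    using \<open>invertible P\<close> by (simp add: invertible_det_nz det_2)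
  moreover have "ev g x y = l * ev f (P$1$1 * x + P$1$2 * y + v$1) (P$2$1 * x + P$2$2 * y + v$2)" for x y
    unfolding g by (simp add: ev_subst_bp)
  ultimately show ?R
    using \<open>l \<noteq> 0\<close> by blast
next
  assume ?R
  then obtain p q r s m n l where *: "p * s - q * r \<noteq> 0" "l \<noteq> 0"
    "\<And>x y. ev g x y = l * ev f (p * x + q * y + m) (r * x + s * y + n)"
    by blast
  define P where "P = (vector [vector [p, q], vector [r, s]] :: real^2^2)"
  define v where "v = (vector [m, n] :: real^2)"
  have "invertible P"
    using * by (simp add: invertible_det_nz det_2 P_def)
  moreover have "g = const_bp l * subst_bp f
              (const_bp (P$1$1) * x_bp + const_bp (P$1$2) * y_bp + const_bp (v$1))
              (const_bp (P$2$1) * x_bp + const_bp (P$2$2) * y_bp + const_bp (v$2))"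
    by (rule bipoly_eqI) (simp add: ev_subst_bp * P_def v_def)
  ultimately show ?L
    using *(2) unfolding equivalent_bp_def by (intro exI[of _ P] exI[of _ v] exI[of _ l] conjI)
qed

lemma equivalent_bp_trans:
  assumes "f \<sim>\<^sub>b g" "g \<sim>\<^sub>b h"
  shows "f \<sim>\<^sub>b h"
proof -
  obtain p q r s m n l where 1: "p * s - q * r \<noteq> 0" "l \<noteq> 0"
    "\<And>x y. ev g x y = l * ev f (p * x + q * y + m) (r * x + s * y + n)"
    using assms(1) unfolding equivalent_bp_iff by blast
  obtain p' q' r' s' m' n' l' where 2: "p' * s' - q' * r' \<noteq> 0" "l' \<noteq> 0"
    "\<And>x y. ev h x y = l' * ev g (p' * x + q' * y + m') (r' * x + s' * y + n')"
    using assms(2) unfolding equivalent_bp_iff by blast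
  \<comment> \<open>Multiplicativity of the determinant for the linear part of the composed affine
    map.\<close>
  have "(p*p' + q*r') * (r*q' + s * s') - (p*q' + q * s') * (r*p' + s*r')
      = (p * s - q * r) * (p' * s' - q' * r')"
    by (simp add: algebra_simps)
  then have "(p*p' + q*r') * (r*q' + s * s') - (p*q' + q * s') * (r*p' + s*r') \<noteq> 0"
    using 1(1) 2(1) by simp
  moreover have "ev h x y = l * l' * ev f
      ((p*p' + q*r') * x + (p*q' + q * s') * y + (p*m' + q*n' + m))
      ((r*p' + s*r') * x + (r*q' + s * s') * y + (r*m' + s*n' + n))" for x y
    unfolding 2(3) 1(3) by (simp add: algebra_simps)
  moreover have "l * l' \<noteq> 0"
    using 1(2) 2(2) by simp
  ultimately show ?thesis
    unfolding equivalent_bp_iff by blast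
qed

lemma equivalent_bp_sym:
  assumes "f \<sim>\<^sub>b g"
  shows "g \<sim>\<^sub>b f"
proof -
  obtain p q r s m n l where 1: "p * s - q * r \<noteq> 0" "l \<noteq> 0"
    "\<And>x y. ev g x y = l * ev f (p * x + q * y + m) (r * x + s * y + n)"
    using assms unfolding equivalent_bp_iff by blast
  define D where "D = p * s - q * r"
  have D: "D \<noteq> 0" using 1 by (simp add: D_def)
  have det: "(s/D) * (p/D) - (- q/D) * (- r/D) \<noteq> 0"
  proof -
    have "(s/D) * (p/D) - (- q/D) * (- r/D) = 1 / D"
      using D by (simp add: field_simps) (simp add: D_def algebra_simps)
    then show ?thesis using D by simp
  qed
  \<comment> \<open>The inverse affine map: adjugate divided by the determinant \<open>D\<close>,
    and translation by minus the inverse matrix applied to (m, n).\<close>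
  have "p * (s/D * x + - q/D * y + (q*n - s*m)/D) + q * (- r/D * x + p/D * y + (r*m - p*n)/D) + m = x"
    "r * (s/D * x + - q/D * y + (q*n - s*m)/D) + s * (- r/D * x + p/D * y + (r*m - p*n)/D) + n = y" for x y
    using D by (simp_all add: field_simps) (simp_all add: D_def algebra_simps)
  then have "ev f x y = 1/l * ev g (s/D * x + - q/D * y + (q*n - s*m)/D) (- r/D * x + p/D * y + (r*m - p*n)/D)" for x y
    using 1 by simp
  moreover have "1/l \<noteq> 0"
    using 1(2) by simp
  ultimately show ?thesis
    using det unfolding equivalent_bp_iff by blast
qed

subsection \<open>Cubic polynomials\<close>

text \<open>The explicit coefficient list lets derivatives and equality be computed by
  simplification. Arguments are ordered by falling degree, and within a degree by falling power of
  x.\<close>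

definition cubic_bp :: "real \<Rightarrow> real \<Rightarrow> real \<Rightarrow> real \<Rightarrow> real \<Rightarrow> real \<Rightarrow> real \<Rightarrow> real \<Rightarrow> real \<Rightarrow> real \<Rightarrow> bipoly" where
  "cubic_bp a b c d e h k u w z = [: [:z, u, e, a:], [:w, h, b:], [:k, c:], [:d:] :]"

lemma ev_cubic_bp:
  "ev (cubic_bp a b c d e h k u w z) x y =
     a*x^3 + b*x^2*y + c*x*y^2 + d*y^3 + e*x^2 + h*x*y + k*y^2 + u*x + w*y + z"
  by (simp add: ev_def cubic_bp_def algebra_simps power2_eq_square power3_eq_cube)

lemma total_degree_3E:
  assumes "total_degree f = 3"
  obtains a b c d e h k u w z where
    "f = cubic_bp a b c d e h k u w z" "a \<noteq> 0 \<or> b \<noteq> 0 \<or> c \<noteq> 0 \<or> d \<noteq> 0"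
proof -
  let ?S = "{i + j |i j. bcoeff f i j \<noteq> 0}"
  have "f \<noteq> 0" using assms by (auto simp: total_degree_def)
  then have max: "Max ?S = 3"
    using assms by (simp add: total_degree_def)
  \<comment> \<open>\<open>Max\<close> of an infinite set carries no information, so the support is
    first shown to be finite.\<close>
  have "{(i, j). bcoeff f i j \<noteq> 0} \<subseteq> (\<Union>j\<le>degree f. (\<lambda>i. (i, j)) ` {..degree (coeff f j)})"
  proof clarify
    fix i j assume nz: "bcoeff f i j \<noteq> 0"
    then have "j \<le> degree f"
      by (metis bcoeff_def coeff_0 le_degree)
    moreover have "i \<le> degree (coeff f j)"
      using nz by (simp add: bcoeff_def le_degree)
    ultimately show "(i, j) \<in> (\<Union>j\<le>degree f. (\<lambda>i. (i, j)) ` {..degree (coeff f j)})"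
      by auto
  qed
  then have "finite {(i, j). bcoeff f i j \<noteq> 0}"
    by (rule finite_subset) auto
  moreover have S: "?S = (\<lambda>(i, j). i + j) ` {(i, j). bcoeff f i j \<noteq> 0}"
    by auto
  ultimately have fin: "finite ?S"
    by simp
  have vanish: "bcoeff f i j = 0" if "i + j > 3" for i j
    using Max_ge[OF fin, of "i + j"] max that by force
  \<comment> \<open>Nonemptiness ensures that the maximum 3 is attained, which yields a nonzero
    cubic coefficient.\<close>
  have "?S \<noteq> {}"
  proof -
    have "coeff (lead_coeff f) (degree (lead_coeff f)) \<noteq> 0"
      using \<open>f \<noteq> 0\<close> by simp
    then show ?thesis unfolding bcoeff_def by blast
  qed
  then have "3 \<in> ?S" using Max_in[OF fin] max by simp
  then obtain i j where ij: "i + j = 3" "bcoeff f i j \<noteq> 0" by auto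
  then have "i = 3 \<and> j = 0 \<or> i = 2 \<and> j = 1 \<or> i = 1 \<and> j = 2 \<or> i = 0 \<and> j = 3"
    by presburger
  with ij have top: "bcoeff f 3 0 \<noteq> 0 \<or> bcoeff f 2 1 \<noteq> 0 \<or> bcoeff f 1 2 \<noteq> 0 \<or> bcoeff f 0 3 \<noteq> 0"
    by auto
  have "f = cubic_bp (bcoeff f 3 0) (bcoeff f 2 1) (bcoeff f 1 2) (bcoeff f 0 3)
      (bcoeff f 2 0) (bcoeff f 1 1) (bcoeff f 0 2) (bcoeff f 1 0) (bcoeff f 0 1) (bcoeff f 0 0)"
    using vanish
    by (auto simp: poly_eq_iff cubic_bp_def bcoeff_def coeff_pCons split: nat.splits
        simp: numeral_2_eq_2 numeral_3_eq_3)
  with top show ?thesis using that by blast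
qed

lemma homogeneous_component_cubic_bp:
  "homogeneous_component 3 (cubic_bp a b c d e h k u w z) = cubic_bp a b c d 0 0 0 0 0 0"
proof -
  have *: "bcoeff (cubic_bp a b c d e h k u w z) 3 0 = a" "bcoeff (cubic_bp a b c d e h k u w z) 2 1 = b"
    "bcoeff (cubic_bp a b c d e h k u w z) 1 2 = c" "bcoeff (cubic_bp a b c d e h k u w z) 0 3 = d"
    by (simp_all add: bcoeff_def cubic_bp_def eval_nat_numeral)
  have atMost3: "{..3::nat} = {0, 1, 2, 3}" 
    by auto
  have "homogeneous_component 3 (cubic_bp a b c d e h k u w z) =
    const_bp d * y_bp ^ 3 + const_bp c * x_bp * y_bp ^ 2 + const_bp b * x_bp ^ 2 * y_bp + const_bp a * x_bp ^ 3"
    unfolding homogeneous_component_def atMost3 by (simp add: * flip: One_nat_def)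
  then show ?thesis
    by (intro bipoly_eqI) (simp add: ev_cubic_bp)
qed

lemma dx_cubic_bp: "dx (cubic_bp a b c d e h k u w z) = cubic_bp 0 0 0 0 (3*a) (2*b) c (2*e) h u"
  by (simp add: dx_def cubic_bp_def map_poly_pCons pderiv_pCons)

lemma dy_cubic_bp: "dy (cubic_bp a b c d e h k u w z) = cubic_bp 0 0 0 0 b (2*c) (3*d) h (2*k) w"
  by (simp add: dy_def cubic_bp_def pderiv_pCons)

lemma cubic_bp_eq_iff:
  "cubic_bp a b c d e h k u w z = cubic_bp a' b' c' d' e' h' k' u' w' z' \<longleftrightarrow>
     a = a' \<and> b = b' \<and> c = c' \<and> d = d' \<and> e = e' \<and> h = h' \<and> k = k' \<and> u = u' \<and> w = w' \<and> z = z'"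
  by (auto simp: cubic_bp_def)

text \<open>Symmetry of a 2 x 2 product is one equation between its off-diagonal entries. For a
  cubic that equation is affine in x and y, and its coefficients of x, y and 1 give the three
  conditions, the first two after division by 2. The first two involve only the cubic part, the
  third only the quadratic part.\<close>

lemma center_cubic_bp:
  "X \<in> center (cubic_bp a b c d e h k u w z) \<longleftrightarrow>
     3*a * X$1$2 + b * (X$2$2 - X$1$1) - c * X$2$1 = 0 \<and>
     b * X$1$2 + c * (X$2$2 - X$1$1) - 3*d * X$2$1 = 0 \<and>
     2*e * X$1$2 + h * (X$2$2 - X$1$1) - 2*k * X$2$1 = 0"
  unfolding center_def hessian_def const_matrix_def dx_cubic_bp dy_cubic_bp
  by (simp add: vec_eq_iff forall_2 sum_2 transpose_def matrix_matrix_mult_def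
      cubic_bp_def const_bp_def) (auto simp: algebra_simps)

text \<open>Multinomial expansion of a general cubic after an affine substitution, collected by
  monomials. The translation (m, n) enters only from degree 2 downwards.\<close>

lemma cubic_affine_identity:
  fixes a b c d e h k u w z p q r s m n l x y :: real
  shows "l * (a * p^3 + b * p^2 * r + c * p * r^2 + d * r^3) * x^3 +
      l * (3 * a * p^2 * q + b * (p^2 * s + 2 * p * q * r) + c * (2 * p * r * s + q * r^2) + 3 * d * r^2 * s) * x^2 * y +
      l * (3 * a * p * q^2 + b * (q^2 * r + 2 * p * q * s) + c * (p * s^2 + 2 * q * r * s) + 3 * d * r * s^2) * x * y^2 +
      l * (a * q^3 + b * q^2 * s + c * q * s^2 + d * s^3) * y^3 +
      l * (3 * a * p^2 * m + b * (p^2 * n + 2 * p * m * r) + c * (m * r^2 + 2 * p * r * n) + 3 * d * r^2 * n + e * p^2 + h * p * r + k * r^2) * x^2 +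
      l * (6 * a * p * q * m + 2 * b * (p * q * n + p * m * s + q * m * r) + 2 * c * (m * r * s + p * n * s + q * n * r) + 6 * d * r * s * n
         + 2 * e * p * q + h * (p * s + q * r) + 2 * k * r * s) * x * y +
      l * (3 * a * q^2 * m + b * (q^2 * n + 2 * q * m * s) + c * (m * s^2 + 2 * q * s * n) + 3 * d * s^2 * n + e * q^2 + h * q * s + k * s^2) * y^2 +
      l * (3 * a * p * m^2 + b * (2 * p * m * n + m^2 * r) + c * (p * n^2 + 2 * m * r * n) + 3 * d * r * n^2
         + 2 * e * p * m + h * (p * n + m * r) + 2 * k * r * n + u * p + w * r) * x +
      l * (3 * a * q * m^2 + b * (2 * q * m * n + m^2 * s) + c * (q * n^2 + 2 * m * s * n) + 3 * d * s * n^2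
         + 2 * e * q * m + h * (q * n + m * s) + 2 * k * s * n + u * q + w * s) * y +
      l * (a * m^3 + b * m^2 * n + c * m * n^2 + d * n^3 + e * m^2 + h * m * n + k * n^2 + u * m + w * n + z)
   = l * (a * (p * x + q * y + m)^3 + b * (p * x + q * y + m)^2 * (r * x + s * y + n) + c * (p * x + q * y + m) * (r * x + s * y + n)^2
     + d * (r * x + s * y + n)^3 + e * (p * x + q * y + m)^2 + h * (p * x + q * y + m) * (r * x + s * y + n) + k * (r * x + s * y + n)^2
     + u * (p * x + q * y + m) + w * (r * x + s * y + n) + z)"
  unfolding power2_eq_square power3_eq_cube
  by (simp only: distrib_left distrib_right mult.assoc) (simp only: ac_simps)

text \<open>Turns equivalence of cubics into equations between ten coefficients in seven real
  parameters.\<close>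

lemma equivalent_cubic_bp:
  "cubic_bp a b c d e h k u w z \<sim>\<^sub>b g \<longleftrightarrow> (\<exists>p q r s m n l. p * s - q * r \<noteq> 0 \<and> l \<noteq> 0 \<and>
    g = cubic_bp
      (l * (a*p^3 + b*p^2*r + c*p*r^2 + d*r^3))
      (l * (3*a*p^2*q + b*(p^2 * s + 2*p*q*r) + c*(2*p*r * s + q*r^2) + 3*d*r^2 * s))
      (l * (3*a*p*q^2 + b*(q^2*r + 2*p*q * s) + c*(p * s^2 + 2*q*r * s) + 3*d*r * s^2))
      (l * (a*q^3 + b*q^2 * s + c*q * s^2 + d * s^3))
      (l * (3*a*p^2*m + b*(p^2*n + 2*p*m*r) + c*(m*r^2 + 2*p*r*n) + 3*d*r^2*n + e*p^2 + h*p*r + k*r^2))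
      (l * (6*a*p*q*m + 2*b*(p*q*n + p*m * s + q*m*r) + 2*c*(m*r * s + p*n * s + q*n*r) + 6*d*r * s*n
         + 2*e*p*q + h*(p * s + q*r) + 2*k*r * s))
      (l * (3*a*q^2*m + b*(q^2*n + 2*q*m * s) + c*(m * s^2 + 2*q * s*n) + 3*d * s^2*n + e*q^2 + h*q * s + k * s^2))
      (l * (3*a*p*m^2 + b*(2*p*m*n + m^2*r) + c*(p*n^2 + 2*m*r*n) + 3*d*r*n^2
         + 2*e*p*m + h*(p*n + m*r) + 2*k*r*n + u*p + w*r))
      (l * (3*a*q*m^2 + b*(2*q*m*n + m^2 * s) + c*(q*n^2 + 2*m * s*n) + 3*d * s*n^2
         + 2*e*q*m + h*(q*n + m * s) + 2*k * s*n + u*q + w * s))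
      (l * (a*m^3 + b*m^2*n + c*m*n^2 + d*n^3 + e*m^2 + h*m*n + k*n^2 + u*m + w*n + z)))"
proof -
  show ?thesis
    unfolding equivalent_bp_iff
  proof (intro ex_cong1 conj_cong refl, goal_cases)
    case (1 p q r s m n l)
    \<comment> \<open>Once some \<open>F\<close> has the values of the transformed polynomial, the
      pointwise condition on \<open>g\<close> just says that \<open>g\<close> is
      \<open>F\<close>.\<close>
    have *: "(\<forall>x y. ev g x y = l * ev (cubic_bp a b c d e h k u w z) (p * x + q * y + m) (r * x + s * y + n))
      \<longleftrightarrow> g = F"
      if "\<And>x y. ev F x y = l * ev (cubic_bp a b c d e h k u w z) (p * x + q * y + m) (r * x + s * y + n)" for F
      by (auto simp: that[symmetric] intro: bipoly_eqI)
    show ?case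
    proof (rule *, goal_cases)
      case (1 x y)
      show ?case
        unfolding ev_cubic_bp by (rule cubic_affine_identity)
    qed
  qed
qed

subsection \<open>The center under equivalence\<close>

lemma mat2_mult_entries:
  fixes A B :: "'a::semiring_1^2^2"
  shows "(A ** B)$1$1 = A$1$1 * B$1$1 + A$1$2 * B$2$1" "(A ** B)$1$2 = A$1$1 * B$1$2 + A$1$2 * B$2$2"
    "(A ** B)$2$1 = A$2$1 * B$1$1 + A$2$2 * B$2$1" "(A ** B)$2$2 = A$2$1 * B$1$2 + A$2$2 * B$2$2"
  by (simp_all add: matrix_matrix_mult_def sum_2)

lemma mat2_eq_iff:
  fixes A B :: "'a^2^2"
  shows "A = B \<longleftrightarrow> A$1$1 = B$1$1 \<and> A$1$2 = B$1$2 \<and> A$2$1 = B$2$1 \<and> A$2$2 = B$2$2"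
  by (auto simp: vec_eq_iff forall_2)

lemma mat2_one_entries:
  "(mat 1 :: real^2^2)$1$1 = 1" "(mat 1 :: real^2^2)$1$2 = 0" "(mat 1 :: real^2^2)$2$1 = 0" "(mat 1 :: real^2^2)$2$2 = 1"
  by (simp_all add: mat_def)

text \<open>
  If \<open>M\<close> is symmetric, then the antisymmetric part of \<open>P\<^sup>T M P X = P\<^sup>T M (P X P\<^sup>-\<^sup>1) P\<close> is that of
  \<open>M (P X P\<^sup>-\<^sup>1)\<close> times \<open>det P\<close>; so \<open>X\<close> is in the center of the transformed polynomial iff
  \<open>P X P\<^sup>-\<^sup>1\<close> is in the center of the original one.
\<close>

lemma center_equivalent:
  assumes "f \<sim>\<^sub>b g" and f: "f = cubic_bp a b c d e h k u w z"
  obtains P Q :: "real^2^2" where "P ** Q = mat 1" "Q ** P = mat 1"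
    "center f = (\<lambda>X. P ** X ** Q) ` center g"
    "center (homogeneous_component 3 f) = (\<lambda>X. P ** X ** Q) ` center (homogeneous_component 3 g)"
proof -
  obtain p q r s m n l a' b' c' d' e' h' k' u' w' z' where
    D: "p * s - q * r \<noteq> 0" and l: "l \<noteq> 0" and
    g: "g = cubic_bp a' b' c' d' e' h' k' u' w' z'" and
    coeffs: "a' = l * (a*p^3 + b*p^2*r + c*p*r^2 + d*r^3)"
      "b' = l * (3*a*p^2*q + b*(p^2 * s + 2*p*q*r) + c*(2*p*r * s + q*r^2) + 3*d*r^2 * s)"
      "c' = l * (3*a*p*q^2 + b*(q^2*r + 2*p*q * s) + c*(p * s^2 + 2*q*r * s) + 3*d*r * s^2)"
      "d' = l * (a*q^3 + b*q^2 * s + c*q * s^2 + d * s^3)"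
      "e' = l * (3*a*p^2*m + b*(p^2*n + 2*p*m*r) + c*(m*r^2 + 2*p*r*n) + 3*d*r^2*n + e*p^2 + h*p*r + k*r^2)"
      "h' = l * (6*a*p*q*m + 2*b*(p*q*n + p*m * s + q*m*r) + 2*c*(m*r * s + p*n * s + q*n*r) + 6*d*r * s*n
         + 2*e*p*q + h*(p * s + q*r) + 2*k*r * s)"
      "k' = l * (3*a*q^2*m + b*(q^2*n + 2*q*m * s) + c*(m * s^2 + 2*q * s*n) + 3*d * s^2*n + e*q^2 + h*q * s + k * s^2)"
    using assms(1) unfolding f equivalent_cubic_bp by blast
  define \<delta> where "\<delta> = p * s - q * r"
  have \<delta>: "\<delta> \<noteq> 0" using D by (simp add: \<delta>_def)
  define P where "P = (vector [vector [p, q], vector [r, s]] :: real^2^2)"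
  define Q where "Q = (vector [vector [s / \<delta>, - q / \<delta>], vector [- r / \<delta>, p / \<delta>]] :: real^2^2)"
  have PQ: "P ** Q = mat 1"
    unfolding P_def Q_def mat2_eq_iff mat2_mult_entries mat2_one_entries
    using \<delta> by (simp add: field_simps) (simp add: \<delta>_def algebra_simps)
  then have QP: "Q ** P = mat 1"
    by (simp add: matrix_left_right_inverse)

  \<comment> \<open>The conditions of \<open>center_cubic_bp\<close> see a matrix Y only through
    Y12, Y22 - Y11 and Y21. \<open>U X\<close> lists these three numbers for Y =
    \<open>P ** X ** Q\<close>, multiplied by the determinant to clear denominators.\<close>
  define U where "U = (\<lambda>X::real^2^2. (p^2 * X$1$2 + p * q * (X$2$2 - X$1$1) - q^2 * X$2$1,
    2 * p * r * X$1$2 + (p * s + q * r) * (X$2$2 - X$1$1) - 2 * q * s * X$2$1,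
    - (r^2) * X$1$2 - r * s * (X$2$2 - X$1$1) + s^2 * X$2$1))"
  have entries: "(P ** X ** Q)$1$2 = fst (U X) / \<delta>"
    "(P ** X ** Q)$2$2 - (P ** X ** Q)$1$1 = fst (snd (U X)) / \<delta>"
    "(P ** X ** Q)$2$1 = snd (snd (U X)) / \<delta>" for X
    unfolding P_def Q_def mat2_mult_entries U_def
    by (simp_all add: algebra_simps power2_eq_square flip: add_divide_distrib diff_divide_distrib)
  have div: "\<alpha> * (v1/\<delta>) + \<beta> * (v2/\<delta>) - \<gamma> * (v3/\<delta>) = 0 \<longleftrightarrow> \<alpha> * v1 + \<beta> * v2 - \<gamma> * v3 = 0"
    for \<alpha> \<beta> \<gamma> v1 v2 v3 :: real
  proof -
    have "\<alpha> * (v1/\<delta>) + \<beta> * (v2/\<delta>) - \<gamma> * (v3/\<delta>) = (\<alpha> * v1 + \<beta> * v2 - \<gamma> * v3) / \<delta>"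
      by (simp add: add_divide_distrib diff_divide_distrib)
    with \<delta> show ?thesis by simp
  qed
  define EA where "EA = (\<lambda>(v1, v2, v3). 3*a * v1 + b * v2 - c * v3)"
  define EB where "EB = (\<lambda>(v1, v2, v3). b * v1 + c * v2 - 3*d * v3)"
  define EC where "EC = (\<lambda>(v1, v2, v3). 2*e * v1 + h * v2 - 2*k * v3)"
  \<comment> \<open>The quadratic coefficients are left free here, so that the fact serves both
    \<open>f\<close> and its cubic part.\<close>
  have mem_f: "P ** X ** Q \<in> center (cubic_bp a b c d e' h' k' u' w' z') \<longleftrightarrow>
     EA (U X) = 0 \<and> EB (U X) = 0 \<and> 2*e' * fst (U X) + h' * fst (snd (U X)) - 2*k' * snd (snd (U X)) = 0"
    for X e' h' k' u' w' z'
    unfolding center_cubic_bp entries div EA_def EB_def by (simp add: case_prod_beta)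
  \<comment> \<open>The x- and y-conditions of the transformed cubic arise from those of the
    original by the transpose of \<open>P\<close>; in \<open>C\<close> below, the translation adds
    multiples of them to the constant condition.\<close>
  have A: "3*a' * X$1$2 + b' * (X$2$2 - X$1$1) - c' * X$2$1 = l * (p * EA (U X) + r * EB (U X))" for X :: "real^2^2"
    unfolding coeffs EA_def EB_def U_def split
    by (simp add: algebra_simps power2_eq_square power3_eq_cube)
  have B: "b' * X$1$2 + c' * (X$2$2 - X$1$1) - 3*d' * X$2$1 = l * (q * EA (U X) + s * EB (U X))" for X :: "real^2^2"
    unfolding coeffs EA_def EB_def U_def split
    by (simp add: algebra_simps power2_eq_square power3_eq_cube)
  have C: "2*e' * X$1$2 + h' * (X$2$2 - X$1$1) - 2*k' * X$2$1
      = l * (2 * m * EA (U X) + 2 * n * EB (U X) + EC (U X))" for X :: "real^2^2"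
    unfolding coeffs EA_def EB_def EC_def U_def split
    by (simp add: algebra_simps power2_eq_square power3_eq_cube)
  \<comment> \<open>Cramer's rule: the transpose of \<open>P\<close> is invertible, so both
    combinations vanish only if both conditions do.\<close>
  have solve: "l * (p * \<alpha> + r * \<beta>) = 0 \<and> l * (q * \<alpha> + s * \<beta>) = 0 \<longleftrightarrow> \<alpha> = 0 \<and> \<beta> = 0" for \<alpha> \<beta> :: real
  proof -
    have "\<delta> * \<alpha> = s * (p * \<alpha> + r * \<beta>) - r * (q * \<alpha> + s * \<beta>)"
      "\<delta> * \<beta> = p * (q * \<alpha> + s * \<beta>) - q * (p * \<alpha> + r * \<beta>)"
      by (simp_all add: \<delta>_def algebra_simps)
    then show ?thesis
      using l \<delta> by (metis add_0 diff_0_right mult_eq_0_iff mult_zero_right)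
  qed
  have "X \<in> center g \<longleftrightarrow> EA (U X) = 0 \<and> EB (U X) = 0 \<and> EC (U X) = 0" for X
    unfolding g center_cubic_bp A B C conj_assoc[symmetric] solve using l by auto
  moreover have "P ** X ** Q \<in> center f \<longleftrightarrow> EA (U X) = 0 \<and> EB (U X) = 0 \<and> EC (U X) = 0" for X
    unfolding f mem_f by (simp add: EC_def case_prod_beta)
  ultimately have 1: "X \<in> center g \<longleftrightarrow> P ** X ** Q \<in> center f" for X
    by simp
  have "X \<in> center (homogeneous_component 3 g) \<longleftrightarrow> EA (U X) = 0 \<and> EB (U X) = 0" for X
    unfolding g homogeneous_component_cubic_bp center_cubic_bp A B conj_assoc[symmetric] solve by simp
  moreover have "P ** X ** Q \<in> center (homogeneous_component 3 f) \<longleftrightarrow> EA (U X) = 0 \<and> EB (U X) = 0" for X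
    unfolding f homogeneous_component_cubic_bp mem_f by simp
  ultimately have 2: "X \<in> center (homogeneous_component 3 g) \<longleftrightarrow> P ** X ** Q \<in> center (homogeneous_component 3 f)" for X
    by simp
  \<comment> \<open>Conjugation is onto, so the pointwise equivalences \<open>1\<close> and
    \<open>2\<close> become equalities of images.\<close>
  have "Y = P ** (Q ** Y ** P) ** Q" for Y
    by (metis PQ matrix_mul_assoc matrix_mul_lid matrix_mul_rid)
  then have "S = (\<lambda>X. P ** X ** Q) ` S'" if "\<And>X. X \<in> S' \<longleftrightarrow> P ** X ** Q \<in> S" for S S'
    using that by (metis (no_types, lifting) image_eqI subsetI subset_antisym image_subsetI)
  with 1 2 show ?thesis
    using that[OF PQ QP] by blast
qed

subsection \<open>Reduction to a normal form\<close>

text \<open>The minus signs in front of the right-hand sides are absorbed into the quantified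
  parameters.\<close>

lemma of_newton_form_cubic_bp:
  "of_newton_form N1 f \<longleftrightarrow> (\<exists>a b c d e. f \<sim>\<^sub>b cubic_bp a 0 1 0 b 0 0 c e d)"
  "of_newton_form N2 f \<longleftrightarrow> (\<exists>a b c d. f \<sim>\<^sub>b cubic_bp a 0 0 0 b 1 0 c 0 d)"
  "of_newton_form N3 f \<longleftrightarrow> (\<exists>a b c d. f \<sim>\<^sub>b cubic_bp a 0 0 0 b 0 1 c 0 d)"
  "of_newton_form N4 f \<longleftrightarrow> (\<exists>a b c d. f \<sim>\<^sub>b cubic_bp a 0 0 0 b 0 0 c 1 d)"
proof -
  have "x_bp * y_bp^2 + const_bp e * y_bp -
         (const_bp a * x_bp^3 + const_bp b * x_bp^2 + const_bp c * x_bp + const_bp d)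
      = cubic_bp (-a) 0 1 0 (-b) 0 0 (-c) e (-d)" for a b c d e
    by (rule bipoly_eqI) (simp add: ev_cubic_bp)
  then show "of_newton_form N1 f \<longleftrightarrow> (\<exists>a b c d e. f \<sim>\<^sub>b cubic_bp a 0 1 0 b 0 0 c e d)"
    by simp (metis minus_minus)
  have "x_bp * y_bp -
         (const_bp a * x_bp^3 + const_bp b * x_bp^2 + const_bp c * x_bp + const_bp d)
      = cubic_bp (-a) 0 0 0 (-b) 1 0 (-c) 0 (-d)" for a b c d
    by (rule bipoly_eqI) (simp add: ev_cubic_bp)
  then show "of_newton_form N2 f \<longleftrightarrow> (\<exists>a b c d. f \<sim>\<^sub>b cubic_bp a 0 0 0 b 1 0 c 0 d)"
    by simp (metis minus_minus)
  have "y_bp^2 -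
         (const_bp a * x_bp^3 + const_bp b * x_bp^2 + const_bp c * x_bp + const_bp d)
      = cubic_bp (-a) 0 0 0 (-b) 0 1 (-c) 0 (-d)" for a b c d
    by (rule bipoly_eqI) (simp add: ev_cubic_bp)
  then show "of_newton_form N3 f \<longleftrightarrow> (\<exists>a b c d. f \<sim>\<^sub>b cubic_bp a 0 0 0 b 0 1 c 0 d)"
    by simp (metis minus_minus)
  have "y_bp -
         (const_bp a * x_bp^3 + const_bp b * x_bp^2 + const_bp c * x_bp + const_bp d)
      = cubic_bp (-a) 0 0 0 (-b) 0 0 (-c) 1 (-d)" for a b c d
    by (rule bipoly_eqI) (simp add: ev_cubic_bp)
  then show "of_newton_form N4 f \<longleftrightarrow> (\<exists>a b c d. f \<sim>\<^sub>b cubic_bp a 0 0 0 b 0 0 c 1 d)"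
    by simp (metis minus_minus)
qed

lemma of_newton_form_equivalent:
  assumes "f \<sim>\<^sub>b g" "of_newton_form N g"
  shows "of_newton_form N f"
  using assms by (cases N) (auto intro: equivalent_bp_trans simp del: of_newton_form.simps simp: of_newton_form_cubic_bp, (blast intro: equivalent_bp_trans)+)

text \<open>Transforming back, the original cubic coefficients are linear combinations of the new
  ones, so they would all vanish together.\<close>

lemma cubic_part_nonzero_equivalent:
  assumes "cubic_bp a b c d e h k u w z \<sim>\<^sub>b cubic_bp a' b' c' d' e' h' k' u' w' z'"
    and "a \<noteq> 0 \<or> b \<noteq> 0 \<or> c \<noteq> 0 \<or> d \<noteq> 0"
  shows "a' \<noteq> 0 \<or> b' \<noteq> 0 \<or> c' \<noteq> 0 \<or> d' \<noteq> 0"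
  using equivalent_bp_sym[OF assms(1)] assms(2)
  unfolding equivalent_cubic_bp cubic_bp_eq_iff by auto

lemma monic_cubic_has_root:
  fixes a b c :: real
  obtains t where "t^3 + a * t^2 + b * t + c = 0"
proof -
  \<comment> \<open>A root bound of Cauchy type: at \<open>M\<close> and \<open>-M\<close> the cubic
    term is at least as large as all lower terms together, so the intermediate value theorem
    applies.\<close>
  define M where "M = 1 + \<bar>a\<bar> + \<bar>b\<bar> + \<bar>c\<bar>"
  have M: "M \<ge> 1" by (simp add: M_def)
  have le: "\<bar>a * M^2\<bar> + \<bar>b * M\<bar> + \<bar>c\<bar> \<le> M^3"
  proof -
    have "1 * 1 \<le> M * M" "M * 1 \<le> M * M"
      using M by (intro mult_mono; simp)+
    then have "\<bar>b\<bar> * M \<le> \<bar>b\<bar> * M^2" "\<bar>c\<bar> * 1 \<le> \<bar>c\<bar> * M^2"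
      by (intro mult_left_mono; simp add: power2_eq_square)+
    then have "\<bar>a * M^2\<bar> + \<bar>b * M\<bar> + \<bar>c\<bar> \<le> (\<bar>a\<bar> + \<bar>b\<bar> + \<bar>c\<bar>) * M^2"
      using M by (simp add: abs_mult distrib_right)
    also have "\<dots> \<le> M * M^2"
      by (intro mult_right_mono) (simp_all add: M_def)
    finally show ?thesis by (simp add: power2_eq_square power3_eq_cube)
  qed
  have "\<exists>t\<ge>-M. t \<le> M \<and> t^3 + a * t^2 + b * t + c = 0"
  proof (rule IVT')
    show "(-M)^3 + a * (-M)^2 + b * (-M) + c \<le> 0" 
      using le by (simp add: power3_eq_cube)
    show "0 \<le> M^3 + a * M^2 + b * M + c"
      using le by linarith
  qed (use M in \<open>auto intro!: continuous_intros\<close>)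
  then show ?thesis using that by blast
qed

text \<open>If \<open>a\<close> vanishes, (1, 0) is a zero; otherwise setting s = 1 leaves a cubic
  in one variable, which has a real root.\<close>

lemma cubic_form_has_zero:
  fixes a b c d :: real
  obtains q s where "q \<noteq> 0 \<or> s \<noteq> 0" "a*q^3 + b*q^2 * s + c*q * s^2 + d * s^3 = 0"
proof (cases "a = 0")
  case True
  then show ?thesis using that[of 1 0] by simp
next
  case False
  obtain t where "t^3 + (b/a) * t^2 + (c/a) * t + d/a = 0"
    by (rule monic_cubic_has_root)
  then have "a * (t^3 + (b/a) * t^2 + (c/a) * t + d/a) = 0" by simp
  then have "a * t^3 + b * t^2 + c * t + d = 0"
    using False by (simp add: distrib_left)
  then show ?thesis using that[of t 1] by simp
qed

text \<open>One premise per coefficient: where the target coefficient is existentially quantified,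
  reflexivity instantiates it, and only the prescribed coefficients leave real equations to
  prove.\<close>

lemma equivalent_cubic_bpI:
  assumes "p * s - q * r \<noteq> 0" "l \<noteq> 0"
    "a' = l * (a*p^3 + b*p^2*r + c*p*r^2 + d*r^3)"
    "b' = l * (3*a*p^2*q + b*(p^2 * s + 2*p*q*r) + c*(2*p*r * s + q*r^2) + 3*d*r^2 * s)"
    "c' = l * (3*a*p*q^2 + b*(q^2*r + 2*p*q * s) + c*(p * s^2 + 2*q*r * s) + 3*d*r * s^2)"
    "d' = l * (a*q^3 + b*q^2 * s + c*q * s^2 + d * s^3)"
    "e' = l * (3*a*p^2*m + b*(p^2*n + 2*p*m*r) + c*(m*r^2 + 2*p*r*n) + 3*d*r^2*n + e*p^2 + h*p*r + k*r^2)"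
    "h' = l * (6*a*p*q*m + 2*b*(p*q*n + p*m * s + q*m*r) + 2*c*(m*r * s + p*n * s + q*n*r) + 6*d*r * s*n
         + 2*e*p*q + h*(p * s + q*r) + 2*k*r * s)"
    "k' = l * (3*a*q^2*m + b*(q^2*n + 2*q*m * s) + c*(m * s^2 + 2*q * s*n) + 3*d * s^2*n + e*q^2 + h*q * s + k * s^2)"
    "u' = l * (3*a*p*m^2 + b*(2*p*m*n + m^2*r) + c*(p*n^2 + 2*m*r*n) + 3*d*r*n^2
         + 2*e*p*m + h*(p*n + m*r) + 2*k*r*n + u*p + w*r)"
    "w' = l * (3*a*q*m^2 + b*(2*q*m*n + m^2 * s) + c*(q*n^2 + 2*m * s*n) + 3*d * s*n^2
         + 2*e*q*m + h*(q*n + m * s) + 2*k * s*n + u*q + w * s)"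
    "z' = l * (a*m^3 + b*m^2*n + c*m*n^2 + d*n^3 + e*m^2 + h*m*n + k*n^2 + u*m + w*n + z)"
  shows "cubic_bp a b c d e h k u w z \<sim>\<^sub>b cubic_bp a' b' c' d' e' h' k' u' w' z'"
  unfolding equivalent_cubic_bp using assms by blast

lemma N1_if_y2_coeff_nonzero:
  assumes "c \<noteq> 0"
  shows "of_newton_form N1 (cubic_bp a b c 0 e h k u w z)"
proof -
  \<comment> \<open>The shear \<open>r\<close> removes x^2 y, the shift \<open>m\<close> of x
    removes y^2, and the shift \<open>n\<close> of y then removes x y. Scaling by \<open>1/c\<close>
    makes x y^2 monic.\<close>
  define r where "r = - b / (2 * c)"
  define m where "m = - k / c"
  define n where "n = - (2 * b * m + 2 * c * m * r + h + 2 * k * r) / (2 * c)"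
  have r: "b + 2 * c * r = 0" and m: "c * m + k = 0"
    and n: "2 * b * m + 2 * c * (m * r + n) + h + 2 * k * r = 0"
    using assms by (simp_all add: r_def m_def n_def field_simps)
  show ?thesis
    unfolding of_newton_form_cubic_bp
    by (intro exI, rule equivalent_cubic_bpI[where p = 1 and q = 0 and r = r and s = 1 and m = m and n = n and l = "1/c"])
      (rule refl | (use r m n assms in \<open>simp add: algebra_simps\<close>))+
qed

text \<open>The cubic part is x (a x^2 + b x y + c y^2). It leads to (N1) unless it is a multiple of
  x^3; in that case the terms y^2, x y and y, tried in this order, decide between (N3), (N2) and
  (N4).\<close>

lemma of_newton_form_if_y3_coeff_zero:
  assumes nz: "a \<noteq> 0 \<or> b \<noteq> 0 \<or> c \<noteq> 0"
    and indep: "partials_lin_indep f"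
    and f: "f \<sim>\<^sub>b cubic_bp a b c 0 e h k u w z"
  shows "\<exists>N. of_newton_form N f"
proof -
  let ?g = "cubic_bp a b c 0 e h k u w z"
  have "\<exists>N. of_newton_form N ?g"
  proof -
    consider "c \<noteq> 0" | "c = 0" "b \<noteq> 0" | "c = 0" "b = 0" "a \<noteq> 0"
      using nz by blast
    then show ?thesis
    proof cases
      case 1
      then show ?thesis using N1_if_y2_coeff_nonzero by blast
    next
      case 2
      \<comment> \<open>The cubic part is x^2 (a x + b y). Taking the two linear factors as new
        coordinates, in swapped order, turns it into x y^2.\<close>
      have "\<exists>a' b' e' h' k' u' w' z'. ?g \<sim>\<^sub>b cubic_bp a' b' 1 0 e' h' k' u' w' z'"
        by (intro exI, rule equivalent_cubic_bpI
            [where p = 0 and q = 1 and r = "1/b" and s = "-a/b" and m = 0 and n = 0 and l = 1])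
          (rule refl | (use 2 in \<open>simp add: algebra_simps\<close>))+
      then show ?thesis
        using N1_if_y2_coeff_nonzero[of 1] of_newton_form_equivalent by (metis zero_neq_one)
    next
      case 3
      consider "k \<noteq> 0" | "k = 0" "h \<noteq> 0" | "k = 0" "h = 0" "w \<noteq> 0" | "k = 0" "h = 0" "w = 0"
        by blast
      then show ?thesis
      proof cases
        case k: 1
        \<comment> \<open>Completing the square in y removes both x y and y.\<close>
        define r where "r = - h / (2 * k)"
        define n where "n = - w / (2 * k)"
        have "h + 2 * k * r = 0" "2 * k * n + w = 0"
          using k by (simp_all add: r_def n_def)
        with 3 k have "of_newton_form N3 ?g"
          unfolding of_newton_form_cubic_bp
          by (intro exI, rule_tac equivalent_cubic_bpI
            [where p = 1 and q = 0 and r = r and s = 1 and m = 0 and n = n and l = "1/k"])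
            (rule refl | simp add: algebra_simps)+
        then show ?thesis ..
      next
        case h: 2
        \<comment> \<open>Shifting x absorbs w y into h x y.\<close>
        define m where "m = - w / h"
        have "h * m + w = 0"
          using h by (simp add: m_def)
        with 3 h have "of_newton_form N2 ?g"
          unfolding of_newton_form_cubic_bp
          by (intro exI, rule_tac equivalent_cubic_bpI
            [where p = 1 and q = 0 and r = 0 and s = 1 and m = m and n = 0 and l = "1/h"])
            (rule refl | simp add: algebra_simps)+
        then show ?thesis ..
      next
        case w: 3
        with 3 have "of_newton_form N4 ?g"
          unfolding of_newton_form_cubic_bp
          by (intro exI, rule_tac equivalent_cubic_bpI
            [where p = 1 and q = 0 and r = 0 and s = 1 and m = 0 and n = 0 and l = "1/w"])
            (rule refl | simp add: algebra_simps)+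
        then show ?thesis ..
      next
        case 4
        with 3 have "?g = cubic_bp a 0 0 0 e 0 0 u 0 z"
          by simp
        with equivalent_bp_sym[OF f] obtain p q r s m n l where D: "p * s - q * r \<noteq> 0" and
          f: "f = cubic_bp (l * (a*p^3)) (l * (3*a*p^2*q)) (l * (3*a*p*q^2)) (l * (a*q^3))
              (l * (3*a*p^2*m + e*p^2)) (l * (6*a*p*q*m + 2*e*p*q)) (l * (3*a*q^2*m + e*q^2))
              (l * (3*a*p*m^2 + 2*e*p*m + u*p)) (l * (3*a*q*m^2 + 2*e*q*m + u*q))
              (l * (a*m^3 + e*m^2 + u*m + z))"
          by (auto simp: equivalent_cubic_bp)
        \<comment> \<open>Since \<open>?g\<close> involves x alone, \<open>f\<close> depends only on
          the linear form p x + q y. Its derivative along (q, -p) is therefore zero, while the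
          nonzero determinant keeps (p, q) from being zero.\<close>
        have "const_bp q * dx f + const_bp (-p) * dy f = 0"
          by (rule bipoly_eqI, unfold f dx_cubic_bp dy_cubic_bp ev_simps ev_cubic_bp)
            (simp add: ev_def algebra_simps power2_eq_square power3_eq_cube)
        with indep D have False
          unfolding partials_lin_indep_def by fastforce
        then show ?thesis ..
      qed
    qed
  qed
  then show ?thesis
    using of_newton_form_equivalent[OF f] by blast
qed

lemma ex_of_newton_form:
  assumes "total_degree f = 3" and "partials_lin_indep f"
  shows "\<exists>N. of_newton_form N f"
proof -
  obtain a b c d e h k u w z where f: "f = cubic_bp a b c d e h k u w z"
    and nz: "a \<noteq> 0 \<or> b \<noteq> 0 \<or> c \<noteq> 0 \<or> d \<noteq> 0"
    by (rule total_degree_3E[OF assms(1)])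
  obtain q s where "q \<noteq> 0 \<or> s \<noteq> 0" and zero: "a*q^3 + b*q^2 * s + c*q * s^2 + d * s^3 = 0"
    by (rule cubic_form_has_zero)
  then have D: "s * s - q * (- q) \<noteq> 0"
    by (simp add: sum_squares_eq_zero_iff) auto
  \<comment> \<open>The second column of the matrix is the zero (q, s) of the cubic form, so the new
    coefficient of y^3 is the form's value there. The first column (s, -q) is orthogonal to it,
    making the determinant a positive sum of squares.\<close>
  have "\<exists>a' b' c' e' h' k' u' w' z'. f \<sim>\<^sub>b cubic_bp a' b' c' 0 e' h' k' u' w' z'"
    unfolding f
    by (intro exI, rule equivalent_cubic_bpI
        [where p = s and q = q and r = "-q" and s = s and m = 0 and n = 0 and l = 1])
      (rule refl D | simp add: zero)+
  then obtain a' b' c' e' h' k' u' w' z' where g: "f \<sim>\<^sub>b cubic_bp a' b' c' 0 e' h' k' u' w' z'"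
    by blast
  with nz have "a' \<noteq> 0 \<or> b' \<noteq> 0 \<or> c' \<noteq> 0"
    using cubic_part_nonzero_equivalent unfolding f by blast
  then show ?thesis
    using of_newton_form_if_y3_coeff_zero assms(2) g by blast
qed

subsection \<open>Real algebras\<close>

lemma cring_reals_ring: "cring reals_ring"
proof (rule cringI)
  show "abelian_group reals_ring"
    by (rule abelian_groupI) (auto simp: reals_ring_def intro: exI[of _ "- _"])
  show "comm_monoid reals_ring"
    by (rule comm_monoidI) (auto simp: reals_ring_def)
qed (auto simp: reals_ring_def distrib_right)

text \<open>Transport of structure: an algebra axiom holds in \<open>A\<close> because its image
  under the injective map \<open>h\<close> holds in \<open>B\<close>. Only closure has to be checked
  in \<open>A\<close>, which spares a direct proof that the quotient is an algebra.\<close>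

lemma alg_isomorphicI:
  assumes "real_assoc_algebra B"
    and bij: "bij_betw h (carrier A) (carrier B)"
    and closed: "\<zero>\<^bsub>A\<^esub> \<in> carrier A" "\<one>\<^bsub>A\<^esub> \<in> carrier A"
      "\<And>x y. \<lbrakk>x \<in> carrier A; y \<in> carrier A\<rbrakk> \<Longrightarrow> x \<oplus>\<^bsub>A\<^esub> y \<in> carrier A"
      "\<And>x y. \<lbrakk>x \<in> carrier A; y \<in> carrier A\<rbrakk> \<Longrightarrow> x \<otimes>\<^bsub>A\<^esub> y \<in> carrier A"
      "\<And>r x. x \<in> carrier A \<Longrightarrow> r \<odot>\<^bsub>A\<^esub> x \<in> carrier A"
    and hom: "h \<zero>\<^bsub>A\<^esub> = \<zero>\<^bsub>B\<^esub>" "h \<one>\<^bsub>A\<^esub> = \<one>\<^bsub>B\<^esub>"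
      "\<And>x y. \<lbrakk>x \<in> carrier A; y \<in> carrier A\<rbrakk> \<Longrightarrow> h (x \<oplus>\<^bsub>A\<^esub> y) = h x \<oplus>\<^bsub>B\<^esub> h y"
      "\<And>x y. \<lbrakk>x \<in> carrier A; y \<in> carrier A\<rbrakk> \<Longrightarrow> h (x \<otimes>\<^bsub>A\<^esub> y) = h x \<otimes>\<^bsub>B\<^esub> h y"
      "\<And>r x. x \<in> carrier A \<Longrightarrow> h (r \<odot>\<^bsub>A\<^esub> x) = r \<odot>\<^bsub>B\<^esub> h x"
  shows "A \<cong>\<^sub>A B"
proof -
  interpret B: ring B
    using assms(1) by (simp add: real_assoc_algebra_def)
  interpret BM: Module.module reals_ring B
    using assms(1) by (simp add: real_assoc_algebra_def)
  have B_smult: "(r \<odot>\<^bsub>B\<^esub> x) \<otimes>\<^bsub>B\<^esub> y = r \<odot>\<^bsub>B\<^esub> (x \<otimes>\<^bsub>B\<^esub> y)"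
    "x \<otimes>\<^bsub>B\<^esub> (r \<odot>\<^bsub>B\<^esub> y) = r \<odot>\<^bsub>B\<^esub> (x \<otimes>\<^bsub>B\<^esub> y)"
    if "x \<in> carrier B" "y \<in> carrier B" for r x y
    using assms(1) that by (auto simp: real_assoc_algebra_def)
  have mem: "h x \<in> carrier B" if "x \<in> carrier A" for x
    using bij that by (auto simp: bij_betw_def)
  have eqI: "x = y" if "x \<in> carrier A" "y \<in> carrier A" "h x = h y" for x y
    using bij that by (auto simp: bij_betw_def inj_on_def)
  have "abelian_group A"
  proof (rule abelian_groupI)
    fix x assume x: "x \<in> carrier A"
    then obtain y where "y \<in> carrier A" "h y = \<ominus>\<^bsub>B\<^esub> h x"
      using bij mem[OF x] B.a_inv_closed unfolding bij_betw_def by (metis imageE)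
    then show "\<exists>y\<in>carrier A. y \<oplus>\<^bsub>A\<^esub> x = \<zero>\<^bsub>A\<^esub>"
      using x by (intro bexI[of _ y]) (auto intro!: eqI simp: closed hom mem B.l_neg)
  qed (auto intro!: eqI simp: closed hom mem B.a_ac)
  moreover have "Group.monoid A"
    by (rule monoidI) (auto intro!: eqI simp: closed hom mem B.m_assoc)
  ultimately have "ring A"
    by (rule ringI) (auto intro!: eqI simp: closed hom mem B.l_distr B.r_distr)
  moreover have "Module.module reals_ring A"
  proof (rule moduleI)
    show "cring reals_ring" by (rule cring_reals_ring)
  qed (use \<open>abelian_group A\<close> in
      \<open>auto intro!: eqI simp: closed hom mem BM.smult_l_distr BM.smult_r_distr BM.smult_assoc1\<close>)
  moreover have "(r \<odot>\<^bsub>A\<^esub> x) \<otimes>\<^bsub>A\<^esub> y = r \<odot>\<^bsub>A\<^esub> (x \<otimes>\<^bsub>A\<^esub> y) \<and> x \<otimes>\<^bsub>A\<^esub> (r \<odot>\<^bsub>A\<^esub> y) = r \<odot>\<^bsub>A\<^esub> (x \<otimes>\<^bsub>A\<^esub> y)"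
    if "x \<in> carrier A" "y \<in> carrier A" for r x y
    using that by (auto intro!: eqI simp: closed hom mem B_smult)
  ultimately have "real_assoc_algebra A"
    by (auto simp: real_assoc_algebra_def)
  moreover have "h \<in> ring_iso A B"
    using bij mem hom by (intro ring_iso_memI) auto
  ultimately show ?thesis
    using assms(1) hom(5) unfolding alg_isomorphic_def by blast
qed

lemma alg_isomorphic_trans:
  assumes "A \<cong>\<^sub>A B" "B \<cong>\<^sub>A C"
  shows "A \<cong>\<^sub>A C"
proof -
  obtain h k where h: "h \<in> ring_iso A B" "\<forall>r. \<forall>x\<in>carrier A. h (r \<odot>\<^bsub>A\<^esub> x) = r \<odot>\<^bsub>B\<^esub> h x"
    and k: "k \<in> ring_iso B C" "\<forall>r. \<forall>x\<in>carrier B. k (r \<odot>\<^bsub>B\<^esub> x) = r \<odot>\<^bsub>C\<^esub> k x"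
    using assms by (auto simp: alg_isomorphic_def)
  have "k \<circ> h \<in> ring_iso A C"
    using h k by (blast intro: ring_iso_set_trans)
  moreover have "\<forall>r. \<forall>x\<in>carrier A. (k \<circ> h) (r \<odot>\<^bsub>A\<^esub> x) = r \<odot>\<^bsub>C\<^esub> (k \<circ> h) x"
    using h k ring_iso_memE(1)[OF h(1)] by simp
  ultimately show ?thesis
    using assms unfolding alg_isomorphic_def by blast
qed

section \<open>Matrix subalgebras and conjugation\<close>

lemma matrix_add_rdistrib: "(A + B) ** C = A ** C + B ** (C :: 'a::semiring_1^'n^'m)"
  by (simp add: vec_eq_iff matrix_matrix_mult_def sum.distrib distrib_right)

definition matrix_subalgebra :: "(real^2^2) set \<Rightarrow> bool" where
  "matrix_subalgebra S \<longleftrightarrow> mat 1 \<in> S \<and> (\<forall>X\<in>S. \<forall>Y\<in>S. X + Y \<in> S \<and> X ** Y \<in> S) \<and> (\<forall>r. \<forall>X\<in>S. r *\<^sub>R X \<in> S)"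

lemma matrix_subalgebraD:
  assumes "matrix_subalgebra S"
  shows "0 \<in> S" "mat 1 \<in> S" "\<And>X Y. X \<in> S \<Longrightarrow> Y \<in> S \<Longrightarrow> X + Y \<in> S"
    "\<And>X Y. X \<in> S \<Longrightarrow> Y \<in> S \<Longrightarrow> X ** Y \<in> S" "\<And>r X. X \<in> S \<Longrightarrow> r *\<^sub>R X \<in> S"
  using assms scaleR_zero_left[of "mat 1 :: real^2^2"] unfolding matrix_subalgebra_def by metis+

lemma real_assoc_algebra_matrix_alg:
  assumes "matrix_subalgebra S"
  shows "real_assoc_algebra (matrix_alg S)"
proof -
  note S = matrix_subalgebraD[OF assms]
  have "abelian_group (matrix_alg S)"
  proof (rule abelian_groupI)
    fix X assume "X \<in> carrier (matrix_alg S)"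
    then show "\<exists>Y\<in>carrier (matrix_alg S). Y \<oplus>\<^bsub>matrix_alg S\<^esub> X = \<zero>\<^bsub>matrix_alg S\<^esub>"
      using S(5)[of X "-1"] by (intro bexI[of _ "- X"]) (auto simp: matrix_alg_def)
  qed (auto simp: matrix_alg_def S ac_simps)
  moreover have "Group.monoid (matrix_alg S)"
    by (rule monoidI) (auto simp: matrix_alg_def S matrix_mul_assoc)
  ultimately have "ring (matrix_alg S)"
    by (rule ringI) (auto simp: matrix_alg_def matrix_add_ldistrib matrix_add_rdistrib)
  moreover have "Module.module reals_ring (matrix_alg S)"
  proof (rule moduleI)
    show "cring reals_ring" by (rule cring_reals_ring)
  qed (use \<open>abelian_group (matrix_alg S)\<close> in
      \<open>auto simp: matrix_alg_def reals_ring_def S scaleR_left_distrib scaleR_right_distrib\<close>)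
  ultimately show ?thesis
    by (auto simp: real_assoc_algebra_def matrix_alg_def matrix_scalar_ac simp flip: scalar_matrix_assoc)
qed

text \<open>Conjugation is an algebra homomorphism inverted by the opposite conjugation. Both
  directions are stated since a center occurs on the right of an isomorphism with a model algebra,
  but on the left of one with \<open>lower_triangular\<close>.\<close>

lemma matrix_alg_conjugate:
  assumes "matrix_subalgebra S" "P ** Q = mat 1" "Q ** P = mat 1"
  defines "S' \<equiv> (\<lambda>X. P ** X ** Q) ` S"
  shows "matrix_alg S \<cong>\<^sub>A matrix_alg S'" "matrix_alg S' \<cong>\<^sub>A matrix_alg S"
proof -
  note S = matrix_subalgebraD[OF assms(1)]
  let ?h = "\<lambda>X. P ** X ** Q" and ?k = "\<lambda>X. Q ** X ** P"
  have cancel: "Q ** (P ** X) = X" "P ** (Q ** X) = X" for X :: "real^2^2"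
    by (simp_all add: matrix_mul_assoc assms)
  have kh: "?k (?h X) = X" "?h (?k X) = X" for X
    by (simp_all add: matrix_mul_assoc[symmetric] cancel assms)
  have hom: "?h (X ** Y) = ?h X ** ?h Y" "?h (X + Y) = ?h X + ?h Y" "?h (r *\<^sub>R X) = r *\<^sub>R ?h X" "?h 0 = 0"
      "?h (mat 1) = mat 1" for X Y r
    by (simp_all add: matrix_mul_assoc[symmetric] cancel assms matrix_add_ldistrib matrix_add_rdistrib
        matrix_scalar_ac flip: scalar_matrix_assoc)
  have hom': "?k (X ** Y) = ?k X ** ?k Y" "?k (X + Y) = ?k X + ?k Y" "?k (r *\<^sub>R X) = r *\<^sub>R ?k X" "?k 0 = 0"
      "?k (mat 1) = mat 1" for X Y r
    by (simp_all add: matrix_mul_assoc[symmetric] cancel assms matrix_add_ldistrib matrix_add_rdistrib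
        matrix_scalar_ac flip: scalar_matrix_assoc)
  have "matrix_subalgebra S'"
    unfolding matrix_subalgebra_def S'_def ball_simps
  proof (intro conjI ballI allI)
    show "mat 1 \<in> ?h ` S"
      using hom(5) S(2) by (metis imageI)
    show "?h X + ?h Y \<in> ?h ` S" "?h X ** ?h Y \<in> ?h ` S" if "X \<in> S" "Y \<in> S" for X Y
      using that S(3,4) unfolding hom(1,2)[symmetric] by blast+
    show "r *\<^sub>R ?h X \<in> ?h ` S" if "X \<in> S" for r X
      using that S(5) unfolding hom(3)[symmetric] by blast
  qed
  note S' = matrix_subalgebraD[OF this]
  have bij: "bij_betw ?h S S'" "bij_betw ?k S' S"
    by (rule bij_betwI[where g = ?k] bij_betwI[where g = ?h]; auto simp: S'_def kh)+
  show "matrix_alg S \<cong>\<^sub>A matrix_alg S'"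
    by (rule alg_isomorphicI[where h = ?h])
      (use real_assoc_algebra_matrix_alg[OF \<open>matrix_subalgebra S'\<close>] bij in \<open>simp_all add: matrix_alg_def S hom assms(2)\<close>)
  show "matrix_alg S' \<cong>\<^sub>A matrix_alg S"
    by (rule alg_isomorphicI[where h = ?k])
      (use real_assoc_algebra_matrix_alg[OF assms(1)] bij in \<open>simp_all add: matrix_alg_def S' hom' assms(3)\<close>)
qed

section \<open>Matrix models of the algebras and their invariants\<close>

definition diagonal_matrices :: "(real^2^2) set" where
  "diagonal_matrices = {X. X$1$2 = 0 \<and> X$2$1 = 0}"

text \<open>The regular representation of the dual numbers; the entry \<open>X$2$1\<close> is the
  coefficient of epsilon.\<close>

definition dual_matrices :: "(real^2^2) set" where
  "dual_matrices = {X. X$1$2 = 0 \<and> X$1$1 = X$2$2}"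

lemma lower_triangular_eq: "lower_triangular = {X. X$1$2 = 0}"
proof -
  have "X = vector [vector [X$1$1, 0], vector [X$2$1, X$2$2]]" if "X$1$2 = 0" for X :: "real^2^2"
    using that by (simp add: mat2_eq_iff)
  then show ?thesis
    unfolding lower_triangular_def by force
qed

lemma matrix_subalgebra_lower_triangular: "matrix_subalgebra lower_triangular"
  and matrix_subalgebra_diagonal: "matrix_subalgebra diagonal_matrices"
  and matrix_subalgebra_dual: "matrix_subalgebra dual_matrices"
  by (auto simp: matrix_subalgebra_def lower_triangular_eq diagonal_matrices_def dual_matrices_def
      mat2_mult_entries mat2_one_entries)

lemma R2_alg_isomorphic_diagonal: "R2_alg \<cong>\<^sub>A matrix_alg diagonal_matrices"
proof (rule alg_isomorphicI)
  let ?h = "\<lambda>v::real^2. vector [vector [v$1, 0], vector [0, v$2]] :: real^2^2"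
  show "real_assoc_algebra (matrix_alg diagonal_matrices)"
    by (rule real_assoc_algebra_matrix_alg[OF matrix_subalgebra_diagonal])
  show "bij_betw ?h (carrier R2_alg) (carrier (matrix_alg diagonal_matrices))"
    by (rule bij_betwI[where g = "\<lambda>X. vector [X$1$1, X$2$2]"])
      (auto simp: R2_alg_def matrix_alg_def diagonal_matrices_def mat2_eq_iff vec_eq_iff forall_2)
qed (auto simp: R2_alg_def matrix_alg_def mat2_eq_iff mat2_mult_entries mat2_one_entries)

text \<open>A vector whose componentwise square is zero is zero, and an isomorphism preserves this.
  Together with \<open>dual_numbers_alg_nilpotent\<close> it separates (N3) from (N2).\<close>

lemma R2_alg_no_nilpotents:
  assumes "R2_alg \<cong>\<^sub>A matrix_alg S" "X \<in> S" "X ** X = 0"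
  shows "X = 0"
proof -
  obtain h where h: "h \<in> ring_iso R2_alg (matrix_alg S)"
    using assms(1) by (auto simp: alg_isomorphic_def)
  have add: "h (v + w) = h v + h w" and mult: "h (v * w) = h v ** h w" for v w
    using ring_iso_memE(2,3)[OF h, of v w] by (simp_all add: R2_alg_def matrix_alg_def)
  have bij: "bij_betw h UNIV S"
    using ring_iso_memE(5)[OF h] by (simp add: R2_alg_def matrix_alg_def)
  have zero: "h 0 = 0"
    using add[of 0 0] by simp
  obtain v where v: "X = h v"
    using bij assms(2) by (auto simp: bij_betw_def)
  then have "h (v * v) = h 0"
    using assms(3) mult zero by simp
  then have "v * v = 0"
    using bij by (auto simp: bij_betw_def dest: injD)
  then have "v = 0"
    by (simp add: vec_eq_iff)
  then show ?thesis
    using v zero by simp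
qed

text \<open>\<open>jet s r\<close> is the coset of \<open>s + r x\<close> modulo \<open>x\<^sup>2\<close>.\<close>

definition jet :: "real \<Rightarrow> real \<Rightarrow> real poly set" where
  "jet s r = {p. coeff p 0 = s \<and> coeff p 1 = r}"

lemma mem_jet: "p \<in> jet (coeff p 0) (coeff p 1)" "[:s, r:] \<in> jet s r"
  by (simp_all add: jet_def)

lemma jet_eq_iff: "jet s r = jet s' r' \<longleftrightarrow> s = s' \<and> r = r'"
proof
  assume "jet s r = jet s' r'"
  with mem_jet(2)[of s r] have "[:s, r:] \<in> jet s' r'"
    by simp
  then show "s = s' \<and> r = r'"
    by (simp add: jet_def)
qed simp

lemma cring_poly_alg: "cring poly_alg"
proof (rule cringI)
  show "abelian_group poly_alg"
    by (rule abelian_groupI) (auto simp: poly_alg_def add_ac intro: exI[of _ "- _"])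
  show "comm_monoid poly_alg"
    by (rule comm_monoidI) (auto simp: poly_alg_def mult_ac)
qed (auto simp: poly_alg_def distrib_right)

lemma genideal_x_squared: "Idl\<^bsub>poly_alg\<^esub> {[:0, 1:]^2} = jet 0 0"
proof -
  have "Idl\<^bsub>poly_alg\<^esub> {[:0, 1:]^2} = PIdl\<^bsub>poly_alg\<^esub> ([:0, 1:]^2)"
    by (rule cring.cgenideal_eq_genideal[OF cring_poly_alg, symmetric]) (simp add: poly_alg_def)
  also have "\<dots> = {q * [:0, 1:]^2 |q. True}"
    by (simp add: cgenideal_def poly_alg_def)
  also have "\<dots> = jet 0 0"
  proof safe
    fix q :: "real poly"
    show "q * [:0, 1:]^2 \<in> jet 0 0"
      by (simp add: jet_def power2_eq_square)
  next
    fix p assume p: "p \<in> jet 0 0"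
    \<comment> \<open>Two coefficients are split off; membership in \<open>jet 0 0\<close> makes
      them zero and leaves a multiple of x^2.\<close>
    obtain a b q where "p = pCons a (pCons b q)"
      by (metis pCons_cases)
    with p have "p = q * [:0, 1:]^2"
      by (simp add: jet_def power2_eq_square)
    then show "\<exists>q. p = q * [:0, 1:]^2 \<and> True"
      by blast
  qed
  finally show ?thesis .
qed

lemma jet_coset: "jet 0 0 +>\<^bsub>poly_alg\<^esub> p = jet (coeff p 0) (coeff p 1)"
proof -
  have "q \<in> (\<lambda>i. i + p) ` jet 0 0" if "q \<in> jet (coeff p 0) (coeff p 1)" for q
    using that by (intro image_eqI[of _ _ "q - p"]) (auto simp: jet_def)
  then show ?thesis
    by (auto simp: a_r_coset_def' poly_alg_def jet_def)
qed

lemma dual_numbers_alg_simps: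
  "carrier dual_numbers_alg = {jet s r |s r. True}"
  "\<zero>\<^bsub>dual_numbers_alg\<^esub> = jet 0 0" "\<one>\<^bsub>dual_numbers_alg\<^esub> = jet 1 0"
  "jet s r \<oplus>\<^bsub>dual_numbers_alg\<^esub> jet s' r' = jet (s + s') (r + r')"
  "jet s r \<otimes>\<^bsub>dual_numbers_alg\<^esub> jet s' r' = jet (s * s') (s * r' + r * s')"
  "t \<odot>\<^bsub>dual_numbers_alg\<^esub> jet s r = jet (t * s) (t * r)"
proof -
  note defs = dual_numbers_alg_def genideal_x_squared quotient_alg_def FactRing_def ring.extend_def
  have "\<exists>p. jet s r = jet (coeff p 0) (coeff p 1)" for s r
    by (rule exI[of _ "[:s, r:]"]) simp
  then show "carrier dual_numbers_alg = {jet s r |s r. True}"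
    by (auto simp: defs A_RCOSETS_def' jet_coset) (auto simp: poly_alg_def)
  show "\<zero>\<^bsub>dual_numbers_alg\<^esub> = jet 0 0"
    by (simp add: defs)
  show "\<one>\<^bsub>dual_numbers_alg\<^esub> = jet 1 0"
    by (simp add: defs jet_coset) (simp add: poly_alg_def)
  have "jet s r \<oplus>\<^bsub>dual_numbers_alg\<^esub> jet s' r' = (\<Union>a\<in>jet s r. \<Union>b\<in>jet s' r'. {a + b})"
    by (simp add: defs set_add_def' poly_alg_def)
  also have "\<dots> = jet (s + s') (r + r')"
  proof (intro subset_antisym subsetI)
    fix p assume "p \<in> jet (s + s') (r + r')"
    \<comment> \<open>The sum of cosets is elementwise, so every member of the target must be split;
      \<open>[:s, r:]\<close> serves as first summand.\<close>
    then have "p = [:s, r:] + (p - [:s, r:])" "p - [:s, r:] \<in> jet s' r'"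
      by (simp_all add: jet_def)
    then show "p \<in> (\<Union>a\<in>jet s r. \<Union>b\<in>jet s' r'. {a + b})"
      using mem_jet(2) by blast
  qed (auto simp: jet_def)
  finally show "jet s r \<oplus>\<^bsub>dual_numbers_alg\<^esub> jet s' r' = jet (s + s') (r + r')" .
  have coeff_1_mult: "coeff (p * q) (Suc 0) = coeff p 0 * coeff q (Suc 0) + coeff p (Suc 0) * coeff q 0" for p q :: "real poly"
    by (simp add: coeff_mult)
  \<comment> \<open>All products of representatives lie in one coset, so the union in
    \<open>rcoset_mult\<close> is a union of equal sets.\<close>
  have "jet (coeff (p * q) 0) (coeff (p * q) 1) = jet (s * s') (s * r' + r * s')"
    if "p \<in> jet s r" "q \<in> jet s' r'" for p q
    using that by (simp add: jet_def coeff_mult_0 coeff_1_mult)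
  then show "jet s r \<otimes>\<^bsub>dual_numbers_alg\<^esub> jet s' r' = jet (s * s') (s * r' + r * s')"
    using mem_jet(2)[of s r] mem_jet(2)[of s' r']
    by (simp add: defs rcoset_mult_def jet_coset) (auto simp: poly_alg_def)
  have "jet (coeff (Polynomial.smult t p) 0) (coeff (Polynomial.smult t p) 1) = jet (t * s) (t * r)"
    if "p \<in> jet s r" for p
    using that by (simp add: jet_def)
  then show "t \<odot>\<^bsub>dual_numbers_alg\<^esub> jet s r = jet (t * s) (t * r)"
    using mem_jet(2)[of s r] by (simp add: defs jet_coset) (auto simp: poly_alg_def)
qed

lemma dual_numbers_alg_isomorphic_dual: "dual_numbers_alg \<cong>\<^sub>A matrix_alg dual_matrices"
proof -
  \<comment> \<open>The chosen representative is irrelevant: all members of a jet share the two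
    coefficients read off here.\<close>
  define h :: "real poly set \<Rightarrow> real^2^2" where
    "h = (\<lambda>C. vector [vector [coeff (SOME p. p \<in> C) 0, 0], vector [coeff (SOME p. p \<in> C) 1, coeff (SOME p. p \<in> C) 0]])"
  have h: "h (jet s r) = vector [vector [s, 0], vector [r, s]]" for s r
    using someI[of "\<lambda>p. p \<in> jet s r", OF mem_jet(2)] by (simp add: h_def jet_def)
  show ?thesis
  proof (rule alg_isomorphicI)
    show "real_assoc_algebra (matrix_alg dual_matrices)"
      by (rule real_assoc_algebra_matrix_alg[OF matrix_subalgebra_dual])
    show "bij_betw h (carrier dual_numbers_alg) (carrier (matrix_alg dual_matrices))"
      by (rule bij_betwI[where g = "\<lambda>X. jet (X$1$1) (X$2$1)"])
        (auto simp: dual_numbers_alg_simps matrix_alg_def dual_matrices_def h mat2_eq_iff)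
  qed (auto simp: dual_numbers_alg_simps matrix_alg_def h mat2_eq_iff mat2_mult_entries mat2_one_entries, blast+)
qed

text \<open>The class \<open>jet 0 1\<close> of x is nonzero with square zero, and so is its image
  under an isomorphism.\<close>

lemma dual_numbers_alg_nilpotent:
  assumes "dual_numbers_alg \<cong>\<^sub>A matrix_alg S"
  obtains X where "X \<in> S" "X \<noteq> 0" "X ** X = 0"
proof -
  obtain h where h: "h \<in> ring_iso dual_numbers_alg (matrix_alg S)"
    using assms(1) by (auto simp: alg_isomorphic_def)
  have carrier: "jet s r \<in> carrier dual_numbers_alg" for s r
    by (auto simp: dual_numbers_alg_simps)
  have add: "h (jet (s + s') (r + r')) = h (jet s r) + h (jet s' r')"
    and mult: "h (jet (s * s') (s * r' + r * s')) = h (jet s r) ** h (jet s' r')" for s r s' r'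
    using ring_iso_memE(2,3)[OF h carrier carrier, of s r s' r'] by (simp_all add: dual_numbers_alg_simps matrix_alg_def)
  have zero: "h (jet 0 0) = 0"
    using add[of 0 0 0 0] by simp
  have "h (jet 0 1) \<in> S"
    using ring_iso_memE(1)[OF h carrier] by (simp add: matrix_alg_def)
  moreover have "h (jet 0 1) \<noteq> 0"
    using ring_iso_memE(5)[OF h] carrier zero jet_eq_iff[of 0 1 0 0]
    by (metis bij_betw_imp_inj_on inj_onD zero_neq_one)
  moreover have "h (jet 0 1) ** h (jet 0 1) = 0"
    using mult[of 0 0 1 1] zero by simp
  ultimately show ?thesis by (rule that)
qed

text \<open>Two lower triangular matrix units fail to commute, hence so do their preimages. This
  keeps the commutative center in case (N1) from being isomorphic to
  \<open>lower_triangular\<close>.\<close>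

lemma isomorphic_lower_triangular_not_commutative:
  assumes "matrix_alg S \<cong>\<^sub>A matrix_alg lower_triangular"
  obtains X Y where "X \<in> S" "Y \<in> S" "X ** Y \<noteq> Y ** X"
proof -
  obtain h where h: "h \<in> ring_iso (matrix_alg S) (matrix_alg lower_triangular)"
    using assms(1) by (auto simp: alg_isomorphic_def)
  have mult: "h (X ** Y) = h X ** h Y" if "X \<in> S" "Y \<in> S" for X Y
    using ring_iso_memE(2)[OF h] that by (simp add: matrix_alg_def)
  have surj: "h ` S = lower_triangular"
    using ring_iso_memE(5)[OF h] by (simp add: matrix_alg_def bij_betw_def)
  define E F where "E = (vector [vector [1, 0], vector [0, 0]] :: real^2^2)"
    and "F = (vector [vector [0, 0], vector [1, 0]] :: real^2^2)"
  have "E \<in> lower_triangular" "F \<in> lower_triangular"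
    by (simp_all add: E_def F_def lower_triangular_eq)
  then obtain X Y where "X \<in> S" "Y \<in> S" "h X = E" "h Y = F"
    by (metis surj imageE)
  moreover have "E ** F \<noteq> F ** E"
    by (simp add: E_def F_def mat2_eq_iff mat2_mult_entries)
  ultimately show ?thesis
    using mult that by metis
qed

section \<open>Dimensions and inclusions under conjugation\<close>

lemma inj_conjugate:
  fixes P Q :: "real^2^2"
  assumes "Q ** P = mat 1"
  shows "inj (\<lambda>X. P ** X ** Q)"
proof (rule inj_on_inverseI)
  fix X :: "real^2^2"
  have "Q ** (P ** X ** Q) ** P = (Q ** P) ** X ** (Q ** P)"
    by (simp only: matrix_mul_assoc)
  then show "Q ** (P ** X ** Q) ** P = X"
    by (simp add: assms)
qed

lemma dim_conjugate:
  fixes P Q :: "real^2^2"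
  assumes "Q ** P = mat 1"
  shows "dim ((\<lambda>X. P ** X ** Q) ` S) = dim S"
proof (rule dim_image_eq)
  show "linear (\<lambda>X. P ** X ** Q)"
    by (rule linearI) (simp_all add: matrix_add_ldistrib matrix_add_rdistrib matrix_scalar_ac flip: scalar_matrix_assoc)
  show "inj_on (\<lambda>X. P ** X ** Q) (span S)"
    using inj_conjugate[OF assms] by (rule inj_on_subset) simp
qed

lemma dim_lower_triangular: "dim lower_triangular = 3"
proof -
  \<comment> \<open>Lower triangular matrices form the hyperplane orthogonal to this matrix unit in
    a space of dimension 4.\<close>
  define E where "E = (vector [vector [0, 1], vector [0, 0]] :: real^2^2)"
  have "E \<noteq> 0"
    by (simp add: E_def mat2_eq_iff)
  moreover have "lower_triangular = {X. E \<bullet> X = 0}"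
    by (simp add: lower_triangular_eq E_def inner_vec_def sum_2)
  ultimately show ?thesis
    using dim_hyperplane[of E] by simp
qed

text \<open>The center of a x^3 + x y^2. It is spanned by the identity and a matrix J with J^2 = 3 a
  times the identity, which makes it a commutative algebra of dimension 2.\<close>

definition N1_matrices :: "real \<Rightarrow> (real^2^2) set" where
  "N1_matrices a = {X. X$2$2 = X$1$1 \<and> X$2$1 = 3 * a * X$1$2}"

lemma dim_N1_matrices: "dim (N1_matrices a) = 2"
proof -
  let ?h = "\<lambda>v::real^2. vector [vector [v$1, v$2], vector [3 * a * v$2, v$1]] :: real^2^2"
  have "X = ?h (vector [X$1$1, X$1$2])" if "X \<in> N1_matrices a" for X
    using that by (simp add: mat2_eq_iff N1_matrices_def)
  then have "N1_matrices a \<subseteq> ?h ` UNIV"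
    by blast
  moreover have "?h ` UNIV \<subseteq> N1_matrices a"
    by (auto simp: N1_matrices_def)
  ultimately have "N1_matrices a = ?h ` UNIV"
    by (rule subset_antisym)
  also have "dim (?h ` UNIV) = dim (UNIV :: (real^2) set)"
  proof (rule dim_image_eq)
    show "linear ?h"
      by (rule linearI) (simp_all add: mat2_eq_iff algebra_simps)
    show "inj_on ?h (span UNIV)"
      by (auto intro!: inj_onI simp: mat2_eq_iff vec_eq_iff forall_2)
  qed
  finally show ?thesis by simp
qed

lemma N1_matrices_commute: "X \<in> N1_matrices a \<Longrightarrow> Y \<in> N1_matrices a \<Longrightarrow> X ** Y = Y ** X"
  by (simp add: N1_matrices_def mat2_eq_iff mat2_mult_entries algebra_simps)

lemma conjugate_lower_triangular:
  assumes "P ** Q = mat 1" "Q ** P = mat 1" 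
    and "S = (\<lambda>X. P ** X ** Q) ` lower_triangular"
  shows "matrix_alg S \<cong>\<^sub>A matrix_alg lower_triangular" "dim S \<noteq> 2"
  using matrix_alg_conjugate(2)[OF matrix_subalgebra_lower_triangular assms(1,2)]
    dim_conjugate[OF assms(2), of lower_triangular] by (simp_all add: assms(3) dim_lower_triangular)

lemma conjugate_psubset:
  fixes P Q :: "real^2^2"
  assumes "Q ** P = mat 1" "S \<subset> S'"
  shows "(\<lambda>X. P ** X ** Q) ` S \<subset> (\<lambda>X. P ** X ** Q) ` S'"
  using assms(2) inj_conjugate[OF assms(1)] by (simp add: inj_image_subset_iff psubset_eq inj_image_eq_iff)

subsection \<open>Centers of the normal forms\<close>

text \<open>Moves center computations to a normal form and carries over the nonvanishing of the
  cubic part, which in (N2), (N3) and (N4) means that the coefficient of x^3 is nonzero.\<close>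

lemma center_normal_form:
  assumes deg: "total_degree f = 3" and equiv: "f \<sim>\<^sub>b cubic_bp a b c d e h k u w z" (is "_ \<sim>\<^sub>b ?g")
  obtains P Q :: "real^2^2" where "P ** Q = mat 1" "Q ** P = mat 1"
    "center f = (\<lambda>X. P ** X ** Q) ` center ?g"
    "center (homogeneous_component 3 f) = (\<lambda>X. P ** X ** Q) ` center (cubic_bp a b c d 0 0 0 0 0 0)"
    "a \<noteq> 0 \<or> b \<noteq> 0 \<or> c \<noteq> 0 \<or> d \<noteq> 0"
proof -
  obtain a' b' c' d' e' h' k' u' w' z' where f: "f = cubic_bp a' b' c' d' e' h' k' u' w' z'"
    "a' \<noteq> 0 \<or> b' \<noteq> 0 \<or> c' \<noteq> 0 \<or> d' \<noteq> 0"
    by (rule total_degree_3E[OF deg])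
  obtain P Q :: "real^2^2" where "P ** Q = mat 1" "Q ** P = mat 1"
    "center f = (\<lambda>X. P ** X ** Q) ` center ?g"
    "center (homogeneous_component 3 f) = (\<lambda>X. P ** X ** Q) ` center (homogeneous_component 3 ?g)"
    by (rule center_equivalent[OF equiv f(1)])
  moreover have "a \<noteq> 0 \<or> b \<noteq> 0 \<or> c \<noteq> 0 \<or> d \<noteq> 0"
    by (rule cubic_part_nonzero_equivalent[OF equiv[unfolded f(1)] f(2)])
  ultimately show ?thesis
    unfolding homogeneous_component_cubic_bp by (rule that)
qed

lemma N4_center:
  assumes deg: "total_degree f = 3" and "of_newton_form N4 f"
  shows "center f = center (homogeneous_component 3 f)"
    "matrix_alg (center (homogeneous_component 3 f)) \<cong>\<^sub>A matrix_alg lower_triangular"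
    "dim (center (homogeneous_component 3 f)) \<noteq> 2"
proof -
  obtain a b c d where "f \<sim>\<^sub>b cubic_bp a 0 0 0 b 0 0 c 1 d"
    using assms unfolding of_newton_form_cubic_bp by blast
  then obtain P Q where PQ: "P ** Q = mat 1" "Q ** P = mat 1"
    and cf: "center f = (\<lambda>X. P ** X ** Q) ` center (cubic_bp a 0 0 0 b 0 0 c 1 d)"
    and ch: "center (homogeneous_component 3 f) = (\<lambda>X. P ** X ** Q) ` center (cubic_bp a 0 0 0 0 0 0 0 0 0)"
    and "a \<noteq> 0"
    by (rule center_normal_form[OF deg]) auto
  \<comment> \<open>As \<open>a\<close> is nonzero, the x-condition says X12 = 0; the constant
    condition 2 b X12 = 0 then adds nothing.\<close>
  have "center (cubic_bp a 0 0 0 b 0 0 c 1 d) = lower_triangular"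
    "center (cubic_bp a 0 0 0 0 0 0 0 0 0) = lower_triangular"
    using \<open>a \<noteq> 0\<close> by (auto simp: center_cubic_bp lower_triangular_eq)
  with cf ch PQ conjugate_lower_triangular show "center f = center (homogeneous_component 3 f)"
    "matrix_alg (center (homogeneous_component 3 f)) \<cong>\<^sub>A matrix_alg lower_triangular"
    "dim (center (homogeneous_component 3 f)) \<noteq> 2"
    by simp_all
qed

lemma N3_center:
  assumes deg: "total_degree f = 3" and "of_newton_form N3 f"
  shows "R2_alg \<cong>\<^sub>A matrix_alg (center f)"
    "\<not> dual_numbers_alg \<cong>\<^sub>A matrix_alg (center f)"
    "center f \<subset> center (homogeneous_component 3 f)"
    "matrix_alg (center (homogeneous_component 3 f)) \<cong>\<^sub>A matrix_alg lower_triangular"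
    "dim (center (homogeneous_component 3 f)) \<noteq> 2"
proof -
  obtain a b c d where "f \<sim>\<^sub>b cubic_bp a 0 0 0 b 0 1 c 0 d"
    using assms unfolding of_newton_form_cubic_bp by blast
  then obtain P Q where PQ: "P ** Q = mat 1" "Q ** P = mat 1"
    and cf: "center f = (\<lambda>X. P ** X ** Q) ` center (cubic_bp a 0 0 0 b 0 1 c 0 d)"
    and ch: "center (homogeneous_component 3 f) = (\<lambda>X. P ** X ** Q) ` center (cubic_bp a 0 0 0 0 0 0 0 0 0)"
    and "a \<noteq> 0"
    by (rule center_normal_form[OF deg]) auto
  \<comment> \<open>Given X12 = 0, the term y^2 turns the constant condition into X21 = 0.\<close>
  have 1: "center (cubic_bp a 0 0 0 b 0 1 c 0 d) = diagonal_matrices"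
    and 2: "center (cubic_bp a 0 0 0 0 0 0 0 0 0) = lower_triangular"
    using \<open>a \<noteq> 0\<close> by (auto simp: center_cubic_bp lower_triangular_eq diagonal_matrices_def)
  show R2: "R2_alg \<cong>\<^sub>A matrix_alg (center f)"
    unfolding cf 1 using R2_alg_isomorphic_diagonal
      matrix_alg_conjugate(1)[OF matrix_subalgebra_diagonal PQ] by (rule alg_isomorphic_trans)
  then show "\<not> dual_numbers_alg \<cong>\<^sub>A matrix_alg (center f)"
    using R2_alg_no_nilpotents dual_numbers_alg_nilpotent by metis
  have "(vector [vector [0, 0], vector [1, 0]] :: real^2^2) \<in> lower_triangular - diagonal_matrices"
    by (simp add: lower_triangular_eq diagonal_matrices_def)
  moreover have "diagonal_matrices \<subseteq> lower_triangular"
    by (auto simp: lower_triangular_eq diagonal_matrices_def)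
  ultimately have "diagonal_matrices \<subset> lower_triangular"
    by blast
  then show "center f \<subset> center (homogeneous_component 3 f)"
    unfolding cf ch 1 2 by (rule conjugate_psubset[OF PQ(2)])
  show "matrix_alg (center (homogeneous_component 3 f)) \<cong>\<^sub>A matrix_alg lower_triangular"
    "dim (center (homogeneous_component 3 f)) \<noteq> 2"
    using conjugate_lower_triangular[OF PQ ch[unfolded 2]] .
qed

lemma N2_center:
  assumes deg: "total_degree f = 3" and "of_newton_form N2 f"
  shows "dual_numbers_alg \<cong>\<^sub>A matrix_alg (center f)"
    "\<not> R2_alg \<cong>\<^sub>A matrix_alg (center f)"
    "center f \<subset> center (homogeneous_component 3 f)"
    "matrix_alg (center (homogeneous_component 3 f)) \<cong>\<^sub>A matrix_alg lower_triangular"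
    "dim (center (homogeneous_component 3 f)) \<noteq> 2"
proof -
  obtain a b c d where "f \<sim>\<^sub>b cubic_bp a 0 0 0 b 1 0 c 0 d"
    using assms unfolding of_newton_form_cubic_bp by blast
  then obtain P Q where PQ: "P ** Q = mat 1" "Q ** P = mat 1"
    and cf: "center f = (\<lambda>X. P ** X ** Q) ` center (cubic_bp a 0 0 0 b 1 0 c 0 d)"
    and ch: "center (homogeneous_component 3 f) = (\<lambda>X. P ** X ** Q) ` center (cubic_bp a 0 0 0 0 0 0 0 0 0)"
    and "a \<noteq> 0"
    by (rule center_normal_form[OF deg]) auto
  \<comment> \<open>Given X12 = 0, the term x y turns the constant condition into X22 = X11.\<close>
  have 1: "center (cubic_bp a 0 0 0 b 1 0 c 0 d) = dual_matrices"
    and 2: "center (cubic_bp a 0 0 0 0 0 0 0 0 0) = lower_triangular"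
    using \<open>a \<noteq> 0\<close> by (auto simp: center_cubic_bp lower_triangular_eq dual_matrices_def)
  show D: "dual_numbers_alg \<cong>\<^sub>A matrix_alg (center f)"
    unfolding cf 1 using dual_numbers_alg_isomorphic_dual
      matrix_alg_conjugate(1)[OF matrix_subalgebra_dual PQ] by (rule alg_isomorphic_trans)
  then show "\<not> R2_alg \<cong>\<^sub>A matrix_alg (center f)"
    using R2_alg_no_nilpotents dual_numbers_alg_nilpotent by metis
  have "(vector [vector [1, 0], vector [0, 0]] :: real^2^2) \<in> lower_triangular - dual_matrices"
    by (simp add: lower_triangular_eq dual_matrices_def)
  moreover have "dual_matrices \<subseteq> lower_triangular"
    by (auto simp: lower_triangular_eq dual_matrices_def)
  ultimately have "dual_matrices \<subset> lower_triangular"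
    by blast
  then show "center f \<subset> center (homogeneous_component 3 f)"
    unfolding cf ch 1 2 by (rule conjugate_psubset[OF PQ(2)])
  show "matrix_alg (center (homogeneous_component 3 f)) \<cong>\<^sub>A matrix_alg lower_triangular"
    "dim (center (homogeneous_component 3 f)) \<noteq> 2"
    using conjugate_lower_triangular[OF PQ ch[unfolded 2]] .
qed

lemma N1_center:
  assumes deg: "total_degree f = 3" and "of_newton_form N1 f"
  shows "dim (center (homogeneous_component 3 f)) = 2"
    "\<not> matrix_alg (center (homogeneous_component 3 f)) \<cong>\<^sub>A matrix_alg lower_triangular"
proof -
  obtain a b c d e where "f \<sim>\<^sub>b cubic_bp a 0 1 0 b 0 0 c e d"
    using assms unfolding of_newton_form_cubic_bp by blast
  then obtain P Q where PQ: "P ** Q = mat 1" "Q ** P = mat 1"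
    and ch: "center (homogeneous_component 3 f) = (\<lambda>X. P ** X ** Q) ` center (cubic_bp a 0 1 0 0 0 0 0 0 0)"
    by (rule center_normal_form[OF deg]) auto
  have 1: "center (cubic_bp a 0 1 0 0 0 0 0 0 0) = N1_matrices a"
    by (auto simp: center_cubic_bp N1_matrices_def)
  show "dim (center (homogeneous_component 3 f)) = 2"
    unfolding ch 1 by (simp add: dim_conjugate[OF PQ(2)] dim_N1_matrices)
  \<comment> \<open>Conjugation respects products, so commutativity passes from
    \<open>N1_matrices\<close> to the center of the cubic part.\<close>
  have "(P ** X ** Q) ** (P ** Y ** Q) = P ** (X ** Y) ** Q" for X Y
  proof -
    have "(P ** X ** Q) ** (P ** Y ** Q) = P ** X ** (Q ** P) ** Y ** Q"
      by (simp only: matrix_mul_assoc)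
    then show ?thesis
      by (simp add: PQ(2) matrix_mul_assoc)
  qed
  then have "X ** Y = Y ** X"
    if "X \<in> center (homogeneous_component 3 f)" "Y \<in> center (homogeneous_component 3 f)" for X Y
    using that N1_matrices_commute unfolding ch 1 by auto
  then show "\<not> matrix_alg (center (homogeneous_component 3 f)) \<cong>\<^sub>A matrix_alg lower_triangular"
    using isomorphic_lower_triangular_not_commutative by metis
qed

theorem corollary3p3:
  fixes f :: bipoly
  assumes "total_degree f = 3"
    and "partials_lin_indep f"
  shows "(\<exists>!N. of_newton_form N f) \<and>
    (of_newton_form N4 f \<longleftrightarrow>
       center f = center (homogeneous_component 3 f) \<and>
       matrix_alg (center (homogeneous_component 3 f)) \<cong>\<^sub>A matrix_alg lower_triangular) \<and>
    (of_newton_form N3 f \<longleftrightarrow>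
       R2_alg \<cong>\<^sub>A matrix_alg (center f) \<and>
       center f \<subset> center (homogeneous_component 3 f) \<and>
       matrix_alg (center (homogeneous_component 3 f)) \<cong>\<^sub>A matrix_alg lower_triangular) \<and>
    (of_newton_form N2 f \<longleftrightarrow>
       dual_numbers_alg \<cong>\<^sub>A matrix_alg (center f) \<and>
       center f \<subset> center (homogeneous_component 3 f) \<and>
       matrix_alg (center (homogeneous_component 3 f)) \<cong>\<^sub>A matrix_alg lower_triangular) \<and>
    (of_newton_form N1 f \<longleftrightarrow> dim (center (homogeneous_component 3 f)) = 2)"
proof -
  \<comment> \<open>A form computed from the invariants alone. Every form that \<open>f\<close> has
    must equal it, which gives uniqueness; existence then shows that \<open>f\<close> has it, and
    each equivalence is read off by cases on its value.\<close>
  define form where "form =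
    (if \<not> matrix_alg (center (homogeneous_component 3 f)) \<cong>\<^sub>A matrix_alg lower_triangular then N1
     else if center f = center (homogeneous_component 3 f) then N4
     else if R2_alg \<cong>\<^sub>A matrix_alg (center f) then N3 else N2)"
  have unique: "N = form" if "of_newton_form N f" for N
  proof (cases N)
    case N1
    with that N1_center[OF assms(1)] show ?thesis by (simp add: form_def del: of_newton_form.simps)
  next
    case N2
    with that N2_center(2-4)[OF assms(1)] show ?thesis
      by (simp add: form_def psubset_eq del: of_newton_form.simps)
  next
    case N3
    with that N3_center(1,3,4)[OF assms(1)] show ?thesis
      by (simp add: form_def psubset_eq del: of_newton_form.simps)
  next
    case N4
    with that N4_center(1,2)[OF assms(1)] show ?thesis
      by (simp add: form_def del: of_newton_form.simps)
  qed
  have form: "of_newton_form form f"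
    using ex_of_newton_form[OF assms] unique by metis
  then have iff: "of_newton_form N f \<longleftrightarrow> N = form" for N
    using unique by metis
  show ?thesis
  proof (cases form)
    case N1
    with form N1_center[OF assms(1)] show ?thesis by (simp add: iff)
  next
    case N2
    with form N2_center[OF assms(1)] show ?thesis by (simp add: iff psubset_eq)
  next
    case N3
    with form N3_center[OF assms(1)] show ?thesis by (simp add: iff psubset_eq)
  next
    case N4
    with form N4_center[OF assms(1)] show ?thesis by (simp add: iff)
  qed
qed

end
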